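(* Let $V=V_0\oplus V_1$ be a $\mathbb{Z}_2$-graded complex vector space with $\dim V_0=\dim V_1=k\ge1$, let $n\ge2$, let $S_n$ act on $V^{\otimes n}$ by the sign permutation action $\varphi^*$, and let $\mathcal{A}_n=\mathrm{End}_{\mathbb{C}A_n}(V^{\otimes n})$, $\mathcal{B}_n=\mathrm{End}_{\mathbb{C}S_n}(V^{\otimes n})$. Choose bases $t_1,\dots,t_k$ of $V_0$ and $u_1,\dots,u_k$ of $V_1$, let $\tau\in\mathrm{End}(V)$ be given by $\tau t_i=u_i$, $\tau u_i=t_i$, let $T(y_1\otimes\cdots\otimes y_n)=(-1)^{\sum_{i=1}^n(n-i)\deg y_i}\,\tau y_1\otimes\cdots\otimes\tau y_n$ for homogeneous $y_i$, let $\varepsilon=(-1)^{\binom n2}$ and fix a square root $\sqrt{\varepsilon}\in\mathbb{C}$. Let $\omega:\mathcal{B}_n\to\mathcal{B}_n$, $\omega(b)=\varepsilon\,TbT$ (an automorphism of $\mathcal{B}_n$ of order two), let $H=\{1,\omega\}\cong\mathbb{Z}_2$, and let $\mathcal{B}_n\times\mathbb{C}H$ be the corresponding crossed product. Then the linear map $\zeta:\mathcal{B}_n\times\mathbb{C}H\to\mathcal{A}_n$ determined by $$\zeta(b\otimes1)=b,\qquad \zeta(b\otimes\omega)=\sqrt{\varepsilon}\,bT\qquad(b\in\mathcal{B}_n)$$ is an algebra isomorphism; in particular $\mathcal{A}_n\cong\mathcal{B}_n\times\mathbb{C}H\cong\mathcal{B}_n\times\mathbb{C}\mathbb{Z}_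2$.
   Context: Elements of $V_0$ have degree $0$ and nonzero elements of $V_1$ degree $1$. The sign permutation action: for $\sigma\in S_n$ and homogeneous $v_1,\dots,v_n\in V$, $\varphi^*_\sigma(v_1\otimes\cdots\otimes v_n)=\epsilon\, v_{\sigma^{-1}(1)}\otimes\cdots\otimes v_{\sigma^{-1}(n)}$ with $\epsilon=\prod_{i<j,\ \sigma(i)>\sigma(j)}(-1)^{\deg v_i\deg v_j}$, extended linearly. $\mathcal{B}_n$ (resp. $\mathcal{A}_n$) is the algebra of linear maps on $V^{\otimes n}$ commuting with all $\varphi^*_\sigma$ for $\sigma\in S_n$ (resp. $\sigma$ in the alternating group $A_n$). For a finite group $G$ of automorphisms of an algebra $R$, the crossed product $R\times\mathbb{C}G$ is $R\otimes_{\mathbb{C}}\mathbb{C}G$ with multiplication $(r_1\otimes g_1)(r_2\otimes g_2)=r_1\,g_1(r_2)\otimes g_1g_2$. *)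

theory Defs
  imports Complex_Main "HOL-Algebra.Algebra"
begin

section \<open>Graded vector spaces\<close>

definition is_basis_of ::
  "(complex \<Rightarrow> 'v::ab_group_add \<Rightarrow> 'v) \<Rightarrow> nat \<Rightarrow> (nat \<Rightarrow> 'v) \<Rightarrow> 'v set \<Rightarrow> bool"
  where "is_basis_of sV k t U \<longleftrightarrow>
    inj_on t {1..k} \<and> \<not> Modules.module.dependent sV (t ` {1..k}) \<and>
    Modules.module.span sV (t ` {1..k}) = U"

definition is_graded_space ::
  "(complex \<Rightarrow> 'v::ab_group_add \<Rightarrow> 'v) \<Rightarrow> 'v set \<Rightarrow> 'v set \<Rightarrow> bool"
  where "is_graded_space sV V0 V1 \<longleftrightarrow>
    vector_space sV \<and> Modules.module.subspace sV V0 \<and> Modules.module.subspace sV V1 \<and>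
    V0 \<inter> V1 = {0} \<and> (\<forall>v. \<exists>x\<in>V0. \<exists>y\<in>V1. v = x + y)"

text \<open>Degree of a homogeneous vector, i.e. of an element of \<open>V0 \<union> V1\<close>; the zero vector has
  degree 0.\<close>

definition hdeg :: "'v set \<Rightarrow> 'v \<Rightarrow> nat"
  where "hdeg V0 v = (if v \<in> V0 then 0 else 1)"

section \<open>Tensor powers\<close>

text \<open>The families \<open>v\<close> below are indexed by \<open>nat\<close>, but only their values at the positions
  \<open>1, \<dots>, n\<close> are relevant.\<close>

definition multilinear_map ::
  "nat \<Rightarrow> (complex \<Rightarrow> 'v::ab_group_add \<Rightarrow> 'v) \<Rightarrow> (complex \<Rightarrow> 'x::ab_group_add \<Rightarrow> 'x)
    \<Rightarrow> ((nat \<Rightarrow> 'v) \<Rightarrow> 'x) \<Rightarrow> bool"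
  where "multilinear_map n sV sX f \<longleftrightarrow>
    (\<forall>v v'. (\<forall>i\<in>{1..n}. v i = v' i) \<longrightarrow> f v = f v') \<and>
    (\<forall>i\<in>{1..n}. \<forall>v. Vector_Spaces.linear sV sX (\<lambda>x. f (v(i := x))))"

text \<open>\<open>is_tensor_power n sV sW tens\<close>: the space \<open>W\<close> with
  \<open>tens v = v 1 \<otimes> \<dots> \<otimes> v n\<close> is the \<open>n\<close>-th tensor power of \<open>V\<close>. The universal property is
  required for scalar-valued multilinear maps only, since HOL cannot quantify over target types;
  the property for arbitrary targets follows, see \<open>tensor_power_universal\<close> below.\<close>

definition is_tensor_power ::
  "nat \<Rightarrow> (complex \<Rightarrow> 'v::ab_group_add \<Rightarrow> 'v) \<Rightarrow> (complex \<Rightarrow> 'w::ab_group_add \<Rightarrow> 'w)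
    \<Rightarrow> ((nat \<Rightarrow> 'v) \<Rightarrow> 'w) \<Rightarrow> bool"
  where "is_tensor_power n sV sW tens \<longleftrightarrow>
    vector_space sV \<and> vector_space sW \<and> multilinear_map n sV sW tens \<and>
    (\<forall>f :: (nat \<Rightarrow> 'v) \<Rightarrow> complex. multilinear_map n sV (*) f \<longrightarrow>
      (\<exists>!g. Vector_Spaces.linear sW (*) g \<and> (\<forall>v. g (tens v) = f v)))"

section \<open>The sign permutation action and the operator \<open>T\<close>\<close>

definition koszul_sign :: "nat \<Rightarrow> (nat \<Rightarrow> nat) \<Rightarrow> (nat \<Rightarrow> nat) \<Rightarrow> complex"
  where "koszul_sign n \<sigma> d =
    (\<Prod>(i, j) \<in> {(i, j). i \<in> {1..n} \<and> j \<in> {1..n} \<and> i < j \<and> \<sigma> i > \<sigma> j}. (-1) ^ (d i * d j))"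

text \<open>Both operators are the linear maps with the prescribed values on tensors of homogeneous
  vectors; existence and uniqueness are shown in \<open>sign_action_props\<close> and \<open>twist_T_props\<close>. The inverse
  permutation is written \<open>inv_into UNIV \<sigma>\<close>, as \<open>HOL-Algebra\<close> occupies the notation \<open>inv\<close>.\<close>

definition sign_action ::
  "nat \<Rightarrow> 'v set \<Rightarrow> 'v set \<Rightarrow> (complex \<Rightarrow> 'w::ab_group_add \<Rightarrow> 'w) \<Rightarrow> ((nat \<Rightarrow> 'v) \<Rightarrow> 'w)
    \<Rightarrow> (nat \<Rightarrow> nat) \<Rightarrow> 'w \<Rightarrow> 'w"
  where "sign_action n V0 V1 sW tens \<sigma> = (THE F. Vector_Spaces.linear sW sW F \<and>
    (\<forall>v. (\<forall>i\<in>{1..n}. v i \<in> V0 \<union> V1) \<longrightarrow>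
      F (tens v) = sW (koszul_sign n \<sigma> (\<lambda>i. hdeg V0 (v i))) (tens (\<lambda>i. v (inv_into UNIV \<sigma> i)))))"

definition twist_T ::
  "nat \<Rightarrow> 'v set \<Rightarrow> 'v set \<Rightarrow> (complex \<Rightarrow> 'w::ab_group_add \<Rightarrow> 'w) \<Rightarrow> ((nat \<Rightarrow> 'v) \<Rightarrow> 'w)
    \<Rightarrow> ('v \<Rightarrow> 'v) \<Rightarrow> 'w \<Rightarrow> 'w"
  where "twist_T n V0 V1 sW tens \<tau> = (THE F. Vector_Spaces.linear sW sW F \<and>
    (\<forall>y. (\<forall>i\<in>{1..n}. y i \<in> V0 \<union> V1) \<longrightarrow>
      F (tens y) = sW ((-1) ^ (\<Sum>i=1..n. (n - i) * hdeg V0 (y i))) (tens (\<lambda>i. \<tau> (y i)))))"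

section \<open>Complex algebras\<close>

text \<open>An associative complex algebra is represented by a record of type
  \<open>(complex, 'a) module\<close>, whose scalars are all of the type \<open>complex\<close>. The locale
  \<open>algebra\<close> of \<open>HOL-Algebra\<close> covers commutative algebras only.\<close>

definition commutant_algebra ::
  "(complex \<Rightarrow> 'w::ab_group_add \<Rightarrow> 'w) \<Rightarrow> ('w \<Rightarrow> 'w) set \<Rightarrow> (complex, 'w \<Rightarrow> 'w) module"
  where "commutant_algebra sW S =
    \<lparr>carrier = {b. Vector_Spaces.linear sW sW b \<and> (\<forall>g\<in>S. b \<circ> g = g \<circ> b)},
     monoid.mult = (\<circ>), one = id, ring.zero = (\<lambda>_. 0), ring.add = (\<lambda>a b x. a x + b x),
     smult = (\<lambda>c a x. sW c (a x))\<rparr>"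

definition algebra_linear ::
  "(complex, 'a, 'm) module_scheme \<Rightarrow> (complex, 'b, 'n) module_scheme \<Rightarrow> ('a \<Rightarrow> 'b) set"
  where "algebra_linear R S =
    {h \<in> carrier R \<rightarrow> carrier S.
      (\<forall>x\<in>carrier R. \<forall>y\<in>carrier R. h (x \<oplus>\<^bsub>R\<^esub> y) = h x \<oplus>\<^bsub>S\<^esub> h y) \<and>
      (\<forall>c. \<forall>x\<in>carrier R. h (c \<odot>\<^bsub>R\<^esub> x) = c \<odot>\<^bsub>S\<^esub> h x)}"

definition algebra_iso ::
  "(complex, 'a, 'm) module_scheme \<Rightarrow> (complex, 'b, 'n) module_scheme \<Rightarrow> ('a \<Rightarrow> 'b) set"
  where "algebra_iso R S = ring_iso R S \<inter> algebra_linear R S"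

definition algebra_Aut :: "(complex, 'a, 'm) module_scheme \<Rightarrow> ('a \<Rightarrow> 'a) monoid"
  where "algebra_Aut R = BijGroup (carrier R)
    \<lparr>carrier := algebra_iso R R \<inter> extensional (carrier R)\<rparr>"

text \<open>The crossed product of \<open>R\<close> with a finite group \<open>G\<close> acting on \<open>R\<close> by the automorphisms
  \<open>\<alpha> g\<close>. As the elements of \<open>G\<close> form a basis of the group algebra, an element
  \<open>\<Sum>g. f g \<otimes> g\<close> of the tensor product of \<open>R\<close> with the group algebra is represented by
  its coefficient function \<open>f\<close> on \<open>G\<close>. For a group of automorphisms of \<open>R\<close>, \<open>\<alpha>\<close> is the
  identity.\<close>

definition pure_tensor ::
  "(complex, 'a, 'm) module_scheme \<Rightarrow> ('g, 'q) monoid_scheme \<Rightarrow> 'a \<Rightarrow> 'g \<Rightarrow> ('g \<Rightarrow> 'a)"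
  where "pure_tensor R G r g = (\<lambda>h\<in>carrier G. if h = g then r else \<zero>\<^bsub>R\<^esub>)"

definition crossed_product ::
  "(complex, 'a, 'm) module_scheme \<Rightarrow> ('g, 'q) monoid_scheme \<Rightarrow> ('g \<Rightarrow> 'a \<Rightarrow> 'a)
    \<Rightarrow> (complex, 'g \<Rightarrow> 'a) module"
  where "crossed_product R G \<alpha> =
    \<lparr>carrier = carrier G \<rightarrow>\<^sub>E carrier R,
     monoid.mult = (\<lambda>f1 f2. \<lambda>h\<in>carrier G.
       finsum R (\<lambda>(g1, g2). f1 g1 \<otimes>\<^bsub>R\<^esub> \<alpha> g1 (f2 g2))
         {(g1, g2). g1 \<in> carrier G \<and> g2 \<in> carrier G \<and> g1 \<otimes>\<^bsub>G\<^esub> g2 = h}),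
     one = pure_tensor R G \<one>\<^bsub>R\<^esub> \<one>\<^bsub>G\<^esub>,
     ring.zero = (\<lambda>h\<in>carrier G. \<zero>\<^bsub>R\<^esub>),
     ring.add = (\<lambda>f1 f2. \<lambda>h\<in>carrier G. f1 h \<oplus>\<^bsub>R\<^esub> f2 h),
     smult = (\<lambda>c f. \<lambda>h\<in>carrier G. c \<odot>\<^bsub>R\<^esub> f h)\<rparr>"

lemma crossed_product_pure_mult:
  assumes R: "ring R" and G: "group G" and fin: "finite (carrier G)"
    and \<alpha>: "\<And>g. g \<in> carrier G \<Longrightarrow> \<alpha> g \<in> ring_hom R R"
    and r: "r1 \<in> carrier R" "r2 \<in> carrier R" and g: "g1 \<in> carrier G" "g2 \<in> carrier G"
  shows "pure_tensor R G r1 g1 \<otimes>\<^bsub>crossed_product R G \<alpha>\<^esub> pure_tensor R G r2 g2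
    = pure_tensor R G (r1 \<otimes>\<^bsub>R\<^esub> \<alpha> g1 r2) (g1 \<otimes>\<^bsub>G\<^esub> g2)"
proof
  fix h
  interpret R: ring R by fact
  interpret G: group G by fact
  have cl: "\<alpha> g1 r2 \<in> carrier R"
    using \<alpha>[OF g(1)] r(2) by (rule ring_hom_closed)
  have z: "\<alpha> g \<zero>\<^bsub>R\<^esub> = \<zero>\<^bsub>R\<^esub>" if "g \<in> carrier G" for g
    using ring_hom_zero[OF \<alpha>[OF that] R R] .
  let ?P = "{(a, b). a \<in> carrier G \<and> b \<in> carrier G \<and> a \<otimes>\<^bsub>G\<^esub> b = h}"
  let ?F = "\<lambda>(a, b). pure_tensor R G r1 g1 a \<otimes>\<^bsub>R\<^esub> \<alpha> a (pure_tensor R G r2 g2 b)"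
  have finP: "finite ?P"
    by (rule finite_subset[of _ "carrier G \<times> carrier G"]) (auto simp: fin)
  have F: "?F p = (if p = (g1, g2) then r1 \<otimes>\<^bsub>R\<^esub> \<alpha> g1 r2 else \<zero>\<^bsub>R\<^esub>)" if "p \<in> ?P" for p
  proof -
    obtain a b where p: "p = (a, b)" by (cases p)
    have ab: "a \<in> carrier G" "b \<in> carrier G" using that p by auto
    have c: "\<alpha> a r2 \<in> carrier R" using \<alpha>[OF ab(1)] r(2) by (rule ring_hom_closed)
    show ?thesis using ab c r unfolding p
      by (auto simp: pure_tensor_def z)
  qed
  show "(pure_tensor R G r1 g1 \<otimes>\<^bsub>crossed_product R G \<alpha>\<^esub> pure_tensor R G r2 g2) h
    = pure_tensor R G (r1 \<otimes>\<^bsub>R\<^esub> \<alpha> g1 r2) (g1 \<otimes>\<^bsub>G\<^esub> g2) h"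
  proof (cases "h \<in> carrier G")
    case False
    then show ?thesis by (simp add: crossed_product_def pure_tensor_def)
  next
    case True
    have "finsum R ?F ?P = finsum R (\<lambda>p. if p = (g1, g2) then r1 \<otimes>\<^bsub>R\<^esub> \<alpha> g1 r2 else \<zero>\<^bsub>R\<^esub>) ?P"
      by (rule R.finsum_cong') (use F r cl in auto)
    also have "\<dots> = (if h = g1 \<otimes>\<^bsub>G\<^esub> g2 then r1 \<otimes>\<^bsub>R\<^esub> \<alpha> g1 r2 else \<zero>\<^bsub>R\<^esub>)"
    proof (cases "h = g1 \<otimes>\<^bsub>G\<^esub> g2")
      case True
      then have "(g1, g2) \<in> ?P" using g by auto
      have "finsum R (\<lambda>p. if (g1, g2) = p then r1 \<otimes>\<^bsub>R\<^esub> \<alpha> g1 r2 else \<zero>\<^bsub>R\<^esub>) ?P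
         = r1 \<otimes>\<^bsub>R\<^esub> \<alpha> g1 r2"
        using R.finsum_singleton[OF \<open>(g1, g2) \<in> ?P\<close> finP, of "\<lambda>_. r1 \<otimes>\<^bsub>R\<^esub> \<alpha> g1 r2"] r cl
        by simp
      moreover have "(\<lambda>p. if (g1, g2) = p then r1 \<otimes>\<^bsub>R\<^esub> \<alpha> g1 r2 else \<zero>\<^bsub>R\<^esub>)
        = (\<lambda>p. if p = (g1, g2) then r1 \<otimes>\<^bsub>R\<^esub> \<alpha> g1 r2 else \<zero>\<^bsub>R\<^esub>)" by auto
      ultimately show ?thesis using True by simp
    next
      case False
      have "finsum R (\<lambda>p. if p = (g1, g2) then r1 \<otimes>\<^bsub>R\<^esub> \<alpha> g1 r2 else \<zero>\<^bsub>R\<^esub>) ?P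
        = finsum R (\<lambda>p. \<zero>\<^bsub>R\<^esub>) ?P"
        by (rule R.finsum_cong') (use False in auto)
      then show ?thesis using False by simp
    qed
    finally show ?thesis using True g
      by (simp add: crossed_product_def) (simp add: pure_tensor_def)
  qed
qed

section \<open>Well-definedness\<close>

context
  fixes n :: nat and sV :: "complex \<Rightarrow> 'v::ab_group_add \<Rightarrow> 'v"
    and sW :: "complex \<Rightarrow> 'w::ab_group_add \<Rightarrow> 'w" and tens :: "(nat \<Rightarrow> 'v) \<Rightarrow> 'w"
  assumes tp: "is_tensor_power n sV sW tens"
begin

interpretation V: vector_space sV using tp by (simp add: is_tensor_power_def)
interpretation W: vector_space sW using tp by (simp add: is_tensor_power_def)
interpretation C: vector_space "(*) :: complex \<Rightarrow> complex \<Rightarrow> complex"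
  by unfold_locales (auto simp: algebra_simps)

lemma tensor_multilinear: "multilinear_map n sV sW tens"
  using tp by (simp add: is_tensor_power_def)

lemma tensor_cong: "(\<And>i. i \<in> {1..n} \<Longrightarrow> v i = v' i) \<Longrightarrow> tens v = tens v'"
  using tensor_multilinear unfolding multilinear_map_def by blast

lemma tensor_span: "W.span (range tens) = UNIV"
proof (rule ccontr)
  interpret WC: vector_space_pair sW "(*) :: complex \<Rightarrow> complex \<Rightarrow> complex" ..
  assume "W.span (range tens) \<noteq> UNIV"
  then obtain w where w: "w \<notin> W.span (range tens)" by auto
  obtain B where B: "B \<subseteq> range tens" "\<not> W.dependent B" "range tens \<subseteq> W.span B"
    using W.maximal_independent_subset[of "range tens"] by metis
  have "W.span B = W.span (range tens)"
    using B(1) B(3) W.span_eq W.span_superset by (metis W.span_mono W.span_span subset_antisym)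
  then have wB: "w \<notin> W.span B" using w by simp
  then have ind: "\<not> W.dependent (insert w B)" using B(2) W.independent_insertI by blast
  obtain g where g: "Vector_Spaces.linear sW (*) g"
      "\<forall>x\<in>insert w B. g x = (if x = w then 1 else 0 :: complex)"
    using WC.linear_independent_extend[OF ind, of "\<lambda>x. if x = w then 1 else 0"] by blast
  have l0: "Vector_Spaces.linear sW (*) (\<lambda>x. 0 :: complex)"
    by (simp add: Vector_Spaces.linear_iff C.vector_space_axioms W.vector_space_axioms)
  have "w \<notin> B" using wB W.span_base by blast
  then have gB: "\<And>x. x \<in> B \<Longrightarrow> g x = 0" using g(2) by auto
  have "g x = 0" if "x \<in> W.span B" for x
    using WC.linear_eq_on[OF g(1) l0 that] gB by blast
  then have gt: "g (tens v) = 0" for v using B(3) by auto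
  have "multilinear_map n sV (*) (\<lambda>v :: nat \<Rightarrow> 'v. 0 :: complex)"
    by (auto simp: multilinear_map_def Vector_Spaces.linear_iff C.vector_space_axioms
        V.vector_space_axioms)
  then have "\<exists>!g. Vector_Spaces.linear sW (*) g \<and> (\<forall>v. g (tens v) = (0::complex))"
    using tp unfolding is_tensor_power_def by blast
  then have "g = (\<lambda>x. 0)" using g(1) gt l0 by blast
  then show False using g(2) by auto
qed

lemma tensor_linear_eqI:
  assumes "Vector_Spaces.linear sW sX F" "Vector_Spaces.linear sW sX G"
    and "\<And>v. F (tens v) = G (tens v)"
  shows "F = G"
proof
  fix w
  interpret X: vector_space sX using assms(1) by (simp add: Vector_Spaces.linear_iff)
  interpret WX: vector_space_pair sW sX ..
  show "F w = G w"
    by (rule WX.linear_eq_on[OF assms(1,2), of w "range tens"]) (auto simp: tensor_span assms(3))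
qed

lemma linear_multilinear:
  assumes "multilinear_map n sV sX f" "Vector_Spaces.linear sX sY l"
  shows "multilinear_map n sV sY (\<lambda>v. l (f v))"
  unfolding multilinear_map_def
proof (intro conjI allI impI ballI)
  fix v v' :: "nat \<Rightarrow> 'v" assume "\<forall>i\<in>{1..n}. v i = v' i"
  then show "l (f v) = l (f v')" using assms(1) unfolding multilinear_map_def by metis
next
  fix i v assume "i \<in> {1..n}"
  then have "Vector_Spaces.linear sV sX (\<lambda>x. f (v(i := x)))"
    using assms(1) unfolding multilinear_map_def by blast
  then show "Vector_Spaces.linear sV sY (\<lambda>x. l (f (v(i := x))))"
    using assms(2) unfolding Vector_Spaces.linear_iff by simp
qed

lemma tensor_power_universal:
  assumes X: "vector_space sX" and f: "multilinear_map n sV sX f"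
  shows "\<exists>!g. Vector_Spaces.linear sW sX g \<and> (\<forall>v. g (tens v) = f v)"
proof (rule ex_ex1I)
  interpret X: vector_space sX by fact
  interpret WX: vector_space_pair sW sX ..
  interpret XC: vector_space_pair sX "(*) :: complex \<Rightarrow> complex \<Rightarrow> complex" ..
  interpret WC: vector_space_pair sW "(*) :: complex \<Rightarrow> complex \<Rightarrow> complex" ..
  obtain B where B: "B \<subseteq> range tens" "\<not> W.dependent B" "range tens \<subseteq> W.span B"
    using W.maximal_independent_subset[of "range tens"] by metis
  have spB: "W.span B = UNIV"
    using W.span_mono[OF B(3)] tensor_span by (simp only: W.span_span top_le)
  obtain g where g: "Vector_Spaces.linear sW sX g"
      "\<forall>x\<in>B. g x = f (SOME v. tens v = x)"
    using WX.linear_independent_extend[OF B(2), of "\<lambda>x. f (SOME v. tens v = x)"] by blast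
  have "g (tens v) = f v" for v
  proof (rule ccontr)
    let ?d = "g (tens v) - f v"
    assume "g (tens v) \<noteq> f v"
    then have "\<not> X.dependent {?d}" by simp
    then obtain l where l: "Vector_Spaces.linear sX (*) l" "l ?d = (1 :: complex)"
      using XC.linear_independent_extend[of "{?d}" "\<lambda>_. 1"] by blast
    have "multilinear_map n sV (*) (\<lambda>v. l (f v))" by (rule linear_multilinear[OF f l(1)])
    then obtain h where h: "Vector_Spaces.linear sW (*) h" "\<And>v. h (tens v) = l (f v)"
      using tp unfolding is_tensor_power_def by blast
    have lg: "Vector_Spaces.linear sW (*) (\<lambda>x. l (g x))"
      using g(1) l(1) unfolding Vector_Spaces.linear_iff by simp
    have "l (g x) = h x" for x
    proof (rule WC.linear_eq_on[OF lg h(1), of x B])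
      show "x \<in> W.span B" using spB by simp
      fix b assume b: "b \<in> B"
      then obtain u where "tens u = b" using B(1) by blast
      then have "tens (SOME v. tens v = b) = b" by (rule someI[where P = "\<lambda>v. tens v = b"])
      then show "l (g b) = h b" using g(2) b h(2) by metis
    qed
    then have "l (g (tens v)) = l (f v)" using h(2) by simp
    then have "l ?d = 0" using XC.linear_diff[OF l(1)] by simp
    then show False using l(2) by simp
  qed
  then show "\<exists>g. Vector_Spaces.linear sW sX g \<and> (\<forall>v. g (tens v) = f v)" using g(1) by blast
next
  fix g g' assume "Vector_Spaces.linear sW sX g \<and> (\<forall>v. g (tens v) = f v)"
    "Vector_Spaces.linear sW sX g' \<and> (\<forall>v. g' (tens v) = f v)"
  then show "g = g'" by (intro tensor_linear_eqI) auto
qed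

lemma tensor_transform_multilinear:
  assumes A: "\<And>i. Vector_Spaces.linear sV sV (A i)" and p: "p permutes {1..n}"
  shows "multilinear_map n sV sW (\<lambda>v. sW c (tens (\<lambda>i. A i (v (p i)))))"
  unfolding multilinear_map_def
proof (intro conjI allI impI ballI)
  fix v v' :: "nat \<Rightarrow> 'v" assume eq: "\<forall>i\<in>{1..n}. v i = v' i"
  have "\<forall>i\<in>{1..n}. A i (v (p i)) = A i (v' (p i))"
    using eq permutes_in_image[OF p] by metis
  then have "tens (\<lambda>i. A i (v (p i))) = tens (\<lambda>i. A i (v' (p i)))"
    by (intro tensor_cong) blast
  then show "sW c (tens (\<lambda>i. A i (v (p i)))) = sW c (tens (\<lambda>i. A i (v' (p i))))" by simp
next
  fix j and v :: "nat \<Rightarrow> 'v" assume j: "j \<in> {1..n}"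
  let ?q = "inv_into UNIV p j"
  have q: "?q \<in> {1..n}" using j permutes_in_image[OF permutes_inv[OF p]] by simp
  have pq: "p i = j \<longleftrightarrow> i = ?q" for i
    using permutes_inverses[OF p] by metis
  have upd: "(\<lambda>i. A i ((v(j := x)) (p i))) = (\<lambda>i. A i (v (p i)))(?q := A ?q x)" for x
    using pq by (auto simp: fun_eq_iff)
  have L: "Vector_Spaces.linear sV sW (\<lambda>x. tens ((\<lambda>i. A i (v (p i)))(?q := x)))"
    using tensor_multilinear q unfolding multilinear_map_def by blast
  show "Vector_Spaces.linear sV sW (\<lambda>x. sW c (tens (\<lambda>i. A i ((v(j := x)) (p i)))))"
    unfolding upd using L A[of ?q] unfolding Vector_Spaces.linear_iff
    by (simp add: W.scale_right_distrib W.scale_left_commute)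
qed

lemma multilinear_sum:
  assumes "finite D" "\<And>d. d \<in> D \<Longrightarrow> multilinear_map n sV sW (f d)"
  shows "multilinear_map n sV sW (\<lambda>v. \<Sum>d\<in>D. f d v)"
  unfolding multilinear_map_def
proof (intro conjI allI impI ballI)
  fix v v' :: "nat \<Rightarrow> 'v" assume eq: "\<forall>i\<in>{1..n}. v i = v' i"
  show "(\<Sum>d\<in>D. f d v) = (\<Sum>d\<in>D. f d v')"
    by (rule sum.cong) (use eq assms(2) in \<open>auto simp: multilinear_map_def\<close>)
next
  fix j and v :: "nat \<Rightarrow> 'v" assume j: "j \<in> {1..n}"
  have "\<And>d. d \<in> D \<Longrightarrow> Vector_Spaces.linear sV sW (\<lambda>x. f d (v(j := x)))"
    using assms(2) j unfolding multilinear_map_def by blast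
  then show "Vector_Spaces.linear sV sW (\<lambda>x. \<Sum>d\<in>D. f d (v(j := x)))"
    unfolding Vector_Spaces.linear_iff
    by (simp add: sum.distrib W.scale_sum_right V.vector_space_axioms W.vector_space_axioms)
qed

lemma tensor_scale:
  assumes "finite S" "S \<subseteq> {1..n}"
  shows "tens (\<lambda>i. if i \<in> S then sV (c i) (v i) else v i) = sW (\<Prod>i\<in>S. c i) (tens v)"
  using assms
proof (induction S rule: finite_induct)
  case empty
  then show ?case by simp
next
  case (insert j S)
  let ?u = "\<lambda>i. if i \<in> S then sV (c i) (v i) else v i"
  have L: "Vector_Spaces.linear sV sW (\<lambda>x. tens (?u(j := x)))"
    using tensor_multilinear insert.prems unfolding multilinear_map_def by blast
  have "(\<lambda>i. if i \<in> insert j S then sV (c i) (v i) else v i) = ?u(j := sV (c j) (v j))"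
    by auto
  then have "tens (\<lambda>i. if i \<in> insert j S then sV (c i) (v i) else v i)
    = sW (c j) (tens (?u(j := v j)))"
    using L unfolding Vector_Spaces.linear_iff by simp
  also have "?u(j := v j) = ?u" using insert.hyps by auto
  finally show ?case using insert by simp
qed

lemma tensor_zero:
  assumes "i \<in> {1..n}" "v i = 0" shows "tens v = 0"
proof -
  have "Vector_Spaces.linear sV sW (\<lambda>x. tens (v(i := x)))"
    using tensor_multilinear assms(1) unfolding multilinear_map_def by blast
  then have "tens (v(i := sV 0 0)) = sW 0 (tens (v(i := 0)))"
    unfolding Vector_Spaces.linear_iff by blast
  then show ?thesis using assms(2) by (metis V.scale_zero_left W.scale_zero_left fun_upd_triv)
qed

context
  fixes V0 V1 :: "'v set"
  assumes gr: "is_graded_space sV V0 V1"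
begin

lemma graded_projections:
  obtains P where "\<And>d. Vector_Spaces.linear sV sV (P d)"
    and "\<And>v. v = P 0 v + P 1 v" and "\<And>v. P 0 v \<in> V0" "\<And>v. P 1 v \<in> V1"
    and "\<And>v d. v \<in> V0 \<union> V1 \<Longrightarrow> d \<le> 1 \<Longrightarrow> P d v = (if d = hdeg V0 v then v else 0)"
proof -
  have s: "V.subspace V0" "V.subspace V1" and int: "V0 \<inter> V1 = {0}"
    and ex: "\<forall>v. \<exists>x\<in>V0. \<exists>y\<in>V1. v = x + y"
    using gr by (auto simp: is_graded_space_def)
  obtain Q0 where Q0: "\<And>v. Q0 v \<in> V0 \<and> (\<exists>y\<in>V1. v = Q0 v + y)" using ex by metis
  define Q1 where "Q1 v = v - Q0 v" for v
  have Q1: "Q1 v \<in> V1" for v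
  proof -
    obtain y where "y \<in> V1" "v = Q0 v + y" using Q0 by blast
    then have "Q1 v = y" unfolding Q1_def by (metis add_diff_cancel_left')
    then show ?thesis using \<open>y \<in> V1\<close> by simp
  qed
  have uniq: "Q0 (x + y) = x" if "x \<in> V0" "y \<in> V1" for x y
  proof -
    have "Q0 (x + y) - x = y - Q1 (x + y)" by (simp add: Q1_def)
    moreover have "Q0 (x + y) - x \<in> V0" using Q0 that s V.subspace_diff by blast
    moreover have "y - Q1 (x + y) \<in> V1" using Q1 that s V.subspace_diff by blast
    ultimately have "Q0 (x + y) - x \<in> V0 \<inter> V1" by simp
    then show ?thesis using int by simp
  qed
  have sum: "Q0 v + Q1 v = v" for v by (simp add: Q1_def)
  have add: "Q0 (v + w) = Q0 v + Q0 w" for v w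
  proof -
    have "Q0 ((Q0 v + Q0 w) + (Q1 v + Q1 w)) = Q0 v + Q0 w"
      by (rule uniq) (use Q0 Q1 s V.subspace_add in blast)+
    moreover have "(Q0 v + Q0 w) + (Q1 v + Q1 w) = v + w" by (simp add: Q1_def)
    ultimately show ?thesis by simp
  qed
  have scale: "Q0 (sV c v) = sV c (Q0 v)" for c v
  proof -
    have "Q0 (sV c (Q0 v) + sV c (Q1 v)) = sV c (Q0 v)"
      by (rule uniq) (use Q0 Q1 s V.subspace_scale in blast)+
    then show ?thesis by (simp add: sum flip: V.scale_right_distrib)
  qed
  define P where "P d = (if d = 0 then Q0 else Q1)" for d :: nat
  have zero: "0 \<in> V0" "0 \<in> V1" using s V.subspace_0 by auto
  show ?thesis
  proof (rule that[of P])
    fix d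
    show "Vector_Spaces.linear sV sV (P d)"
      unfolding Vector_Spaces.linear_iff P_def Q1_def
      by (auto simp: add scale V.vector_space_axioms V.scale_right_diff_distrib)
  next
    fix v and d :: nat assume v: "v \<in> V0 \<union> V1" "d \<le> 1"
    have "Q0 v = v" if "v \<in> V0" using uniq[OF that zero(2)] by simp
    moreover have "Q0 v = 0" if "v \<in> V1" using uniq[OF zero(1) that] by simp
    ultimately show "P d v = (if d = hdeg V0 v then v else 0)"
      using v by (auto simp: P_def Q1_def hdeg_def)
  qed (use Q0 Q1 in \<open>auto simp: P_def sum\<close>)
qed

lemma homogeneous_linear_eqI:
  assumes F: "Vector_Spaces.linear sW sX F" and G: "Vector_Spaces.linear sW sX G"
    and eq: "\<And>v. (\<forall>i\<in>{1..n}. v i \<in> V0 \<union> V1) \<Longrightarrow> F (tens v) = G (tens v)"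
  shows "F = G"
proof (rule tensor_linear_eqI[OF F G])
  obtain P where P: "\<And>v. v = P (0::nat) v + P 1 v" "\<And>v. P 0 v \<in> V0" "\<And>v. P 1 v \<in> V1"
    using graded_projections by metis
  have *: "m \<le> n \<Longrightarrow> (\<forall>i\<in>{m+1..n}. v i \<in> V0 \<union> V1) \<Longrightarrow> F (tens v) = G (tens v)" for m v
  proof (induction m arbitrary: v)
    case 0
    then show ?case using eq by simp
  next
    case (Suc m)
    have L: "Vector_Spaces.linear sV sW (\<lambda>x. tens (v(Suc m := x)))"
      using tensor_multilinear Suc.prems(1) unfolding multilinear_map_def by simp
    have h: "F (tens (v(Suc m := P d (v (Suc m))))) = G (tens (v(Suc m := P d (v (Suc m)))))"
      if "d = 0 \<or> d = 1" for d
    proof (rule Suc.IH)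
      show "m \<le> n" using Suc.prems by simp
      have "P d (v (Suc m)) \<in> V0 \<union> V1" using that P by auto
      then show "\<forall>i\<in>{m + 1..n}. (v(Suc m := P d (v (Suc m)))) i \<in> V0 \<union> V1"
        using Suc.prems(2) by auto
    qed
    have "tens v = tens (v(Suc m := P 0 (v (Suc m)) + P 1 (v (Suc m))))"
      using P(1)[of "v (Suc m)"] by simp
    also have "\<dots> = tens (v(Suc m := P 0 (v (Suc m)))) + tens (v(Suc m := P 1 (v (Suc m))))"
      using L unfolding Vector_Spaces.linear_iff by simp
    finally show ?case using F G h[of 0] h[of 1] unfolding Vector_Spaces.linear_iff by simp
  qed
  show "F (tens v) = G (tens v)" for v using *[of n v] by simp
qed

lemma twist_T_props:
  assumes \<tau>: "Vector_Spaces.linear sV sV \<tau>"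
  shows "Vector_Spaces.linear sW sW (twist_T n V0 V1 sW tens \<tau>)"
    and "\<forall>i\<in>{1..n}. y i \<in> V0 \<union> V1 \<Longrightarrow> twist_T n V0 V1 sW tens \<tau> (tens y)
      = sW ((-1) ^ (\<Sum>i=1..n. (n - i) * hdeg V0 (y i))) (tens (\<lambda>i. \<tau> (y i)))"
proof -
  let ?Q = "\<lambda>F. Vector_Spaces.linear sW sW F \<and>
    (\<forall>y. (\<forall>i\<in>{1..n}. y i \<in> V0 \<union> V1) \<longrightarrow>
      F (tens y) = sW ((-1) ^ (\<Sum>i=1..n. (n - i) * hdeg V0 (y i))) (tens (\<lambda>i. \<tau> (y i))))"
  obtain P where P: "\<And>d. Vector_Spaces.linear sV sV (P (d::nat))"
    "\<And>v d. v \<in> V0 \<union> V1 \<Longrightarrow> d \<le> 1 \<Longrightarrow> P d v = (if d = hdeg V0 v then v else 0)"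
    using graded_projections by metis
  define A where "A i v = \<tau> (P 0 v) + sV ((-1) ^ (n - i)) (\<tau> (P 1 v))" for i v
  have A: "Vector_Spaces.linear sV sV (A i)" for i
    using \<tau> P(1)[of 0] P(1)[of 1] unfolding Vector_Spaces.linear_iff A_def
    by (simp add: V.scale_right_distrib V.scale_left_commute)
  have t0: "\<tau> 0 = 0" using \<tau> unfolding Vector_Spaces.linear_iff by (metis V.scale_zero_left)
  have Ah: "A i v = sV ((-1) ^ ((n - i) * hdeg V0 v)) (\<tau> v)" if "v \<in> V0 \<union> V1" for i v
    using P(2)[OF that, of 0] P(2)[OF that, of 1] by (auto simp: A_def t0 hdeg_def)
  have "multilinear_map n sV sW (\<lambda>v. sW 1 (tens (\<lambda>i. A i (v (id i)))))"
    by (rule tensor_transform_multilinear[OF A permutes_id])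
  then have "multilinear_map n sV sW (\<lambda>v. tens (\<lambda>i. A i (v i)))" by simp
  then obtain F where F: "Vector_Spaces.linear sW sW F" "\<And>v. F (tens v) = tens (\<lambda>i. A i (v i))"
    using tensor_power_universal[OF W.vector_space_axioms] by blast
  have "F (tens y) = sW ((-1) ^ (\<Sum>i=1..n. (n - i) * hdeg V0 (y i))) (tens (\<lambda>i. \<tau> (y i)))"
    if "\<forall>i\<in>{1..n}. y i \<in> V0 \<union> V1" for y
  proof -
    have "F (tens y) = tens (\<lambda>i. if i \<in> {1..n}
        then sV ((-1) ^ ((n - i) * hdeg V0 (y i))) (\<tau> (y i)) else \<tau> (y i))"
      unfolding F(2) by (rule tensor_cong) (use that Ah in auto)
    then show ?thesis by (subst (asm) tensor_scale) (auto simp: power_sum)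
  qed
  then have "?Q F" using F(1) by blast
  then have "\<exists>!F. ?Q F" by (intro ex1I[of ?Q F]) (auto intro!: homogeneous_linear_eqI)
  from theI'[OF this] have "?Q (twist_T n V0 V1 sW tens \<tau>)" unfolding twist_T_def .
  then show "Vector_Spaces.linear sW sW (twist_T n V0 V1 sW tens \<tau>)"
    and "\<forall>i\<in>{1..n}. y i \<in> V0 \<union> V1 \<Longrightarrow> twist_T n V0 V1 sW tens \<tau> (tens y)
      = sW ((-1) ^ (\<Sum>i=1..n. (n - i) * hdeg V0 (y i))) (tens (\<lambda>i. \<tau> (y i)))"
    by blast+
qed

lemma sign_action_props:
  assumes \<sigma>: "\<sigma> permutes {1..n}"
  shows "Vector_Spaces.linear sW sW (sign_action n V0 V1 sW tens \<sigma>)"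
    and "\<forall>i\<in>{1..n}. v i \<in> V0 \<union> V1 \<Longrightarrow> sign_action n V0 V1 sW tens \<sigma> (tens v)
      = sW (koszul_sign n \<sigma> (\<lambda>i. hdeg V0 (v i))) (tens (\<lambda>i. v (inv_into UNIV \<sigma> i)))"
proof -
  let ?Q = "\<lambda>F. Vector_Spaces.linear sW sW F \<and>
    (\<forall>v. (\<forall>i\<in>{1..n}. v i \<in> V0 \<union> V1) \<longrightarrow>
      F (tens v) = sW (koszul_sign n \<sigma> (\<lambda>i. hdeg V0 (v i))) (tens (\<lambda>i. v (inv_into UNIV \<sigma> i))))"
  obtain P where P: "\<And>d. Vector_Spaces.linear sV sV (P (d::nat))"
    "\<And>v d. v \<in> V0 \<union> V1 \<Longrightarrow> d \<le> 1 \<Longrightarrow> P d v = (if d = hdeg V0 v then v else 0)"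
    using graded_projections by metis
  define D where "D = ({1..n} \<rightarrow>\<^sub>E {0, 1::nat})"
  have finD: "finite D" unfolding D_def by (rule finite_PiE) auto
  define f where "f d v = sW (koszul_sign n \<sigma> d) (tens (\<lambda>i. P (d (inv_into UNIV \<sigma> i)) (v (inv_into UNIV \<sigma> i))))"
    for d v
  have i\<sigma>: "inv_into UNIV \<sigma> permutes {1..n}" using \<sigma> by (rule permutes_inv)
  have "multilinear_map n sV sW (f d)" for d
    unfolding f_def by (rule tensor_transform_multilinear[OF _ i\<sigma>]) (rule P(1))
  then have "multilinear_map n sV sW (\<lambda>v. \<Sum>d\<in>D. f d v)" by (intro multilinear_sum finD)
  then obtain F where F: "Vector_Spaces.linear sW sW F" "\<And>v. F (tens v) = (\<Sum>d\<in>D. f d v)"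
    using tensor_power_universal[OF W.vector_space_axioms] by blast
  have "F (tens v) = sW (koszul_sign n \<sigma> (\<lambda>i. hdeg V0 (v i))) (tens (\<lambda>i. v (inv_into UNIV \<sigma> i)))"
    if v: "\<forall>i\<in>{1..n}. v i \<in> V0 \<union> V1" for v
  proof -
    define e where "e = (\<lambda>i\<in>{1..n}. hdeg V0 (v i))"
    have e: "e \<in> D" by (auto simp: e_def D_def hdeg_def)
    have z: "f d v = 0" if d: "d \<in> D" "d \<noteq> e" for d
    proof -
      obtain i where i: "i \<in> {1..n}" "d i \<noteq> hdeg V0 (v i)"
      proof (rule ccontr)
        assume "\<not> thesis"
        then have "\<And>i. i \<in> {1..n} \<Longrightarrow> d i = e i" using that by (auto simp: e_def)
        then have "d = e" using d(1) e unfolding D_def by (intro PiE_ext)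
        then show False using d(2) by simp
      qed
      have "d i \<le> 1" using d(1) i(1) unfolding D_def by (auto dest: PiE_mem)
      then have "P (d i) (v i) = 0" using P(2)[of "v i" "d i"] v i by simp
      moreover have "\<sigma> i \<in> {1..n}" using permutes_in_image[OF \<sigma>] i(1) by blast
      ultimately have "tens (\<lambda>i. P (d (inv_into UNIV \<sigma> i)) (v (inv_into UNIV \<sigma> i))) = 0"
        by (intro tensor_zero[of "\<sigma> i"]) (simp_all add: permutes_inverses(2)[OF \<sigma>])
      then show ?thesis by (simp add: f_def)
    qed
    have "F (tens v) = f e v"
      unfolding F(2) using sum.remove[OF finD e, of "\<lambda>d. f d v"] z by simp
    also have "koszul_sign n \<sigma> e = koszul_sign n \<sigma> (\<lambda>i. hdeg V0 (v i))"
      unfolding koszul_sign_def by (rule prod.cong) (auto simp: e_def)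
    then have "f e v = sW (koszul_sign n \<sigma> (\<lambda>i. hdeg V0 (v i)))
        (tens (\<lambda>i. P (e (inv_into UNIV \<sigma> i)) (v (inv_into UNIV \<sigma> i))))"
      by (simp add: f_def)
    also have "tens (\<lambda>i. P (e (inv_into UNIV \<sigma> i)) (v (inv_into UNIV \<sigma> i))) = tens (\<lambda>i. v (inv_into UNIV \<sigma> i))"
    proof (rule tensor_cong)
      fix i assume "i \<in> {1..n}"
      then have i: "inv_into UNIV \<sigma> i \<in> {1..n}" using permutes_in_image[OF i\<sigma>] by blast
      then have "e (inv_into UNIV \<sigma> i) = hdeg V0 (v (inv_into UNIV \<sigma> i))" by (simp add: e_def)
      moreover have "hdeg V0 (v (inv_into UNIV \<sigma> i)) \<le> 1" by (simp add: hdeg_def)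
      ultimately show "P (e (inv_into UNIV \<sigma> i)) (v (inv_into UNIV \<sigma> i)) = v (inv_into UNIV \<sigma> i)"
        using P(2) v i by simp
    qed
    finally show ?thesis .
  qed
  then have "?Q F" using F(1) by blast
  then have "\<exists>!F. ?Q F" by (intro ex1I[of ?Q F]) (auto intro!: homogeneous_linear_eqI)
  from theI'[OF this] have "?Q (sign_action n V0 V1 sW tens \<sigma>)" unfolding sign_action_def .
  then show "Vector_Spaces.linear sW sW (sign_action n V0 V1 sW tens \<sigma>)"
    and "\<forall>i\<in>{1..n}. v i \<in> V0 \<union> V1 \<Longrightarrow> sign_action n V0 V1 sW tens \<sigma> (tens v)
      = sW (koszul_sign n \<sigma> (\<lambda>i. hdeg V0 (v i))) (tens (\<lambda>i. v (inv_into UNIV \<sigma> i)))"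
    by blast+
qed

end

end

end

theory Submission
  imports Defs
begin

text \<open>The operator \<open>T\<close> satisfies \<open>T \<circ> T = \<epsilon>\<close> and \<open>T \<circ> \<phi> \<sigma> = sign \<sigma> \<cdot> \<phi> \<sigma> \<circ> T\<close>, the
  latter because comparing the signs on both sides reduces to an identity for each pair of positions.
  Hence \<open>U = s T\<close> is an involution which commutes with the even permutations and anticommutes with
  the odd ones. Conjugation with an odd permutation splits an operator commuting with the
  alternating group into a part commuting and a part anticommuting with the odd permutations;
  multiplication with \<open>U\<close> interchanges the two types, so \<open>A\<close> is the direct sum of \<open>B\<close> and \<open>B U\<close>.
  Since conjugation with \<open>U\<close> is \<open>\<omega>\<close>, this is the crossed product.\<close>

section \<open>Koszul signs as products over pairs of positions\<close>

text \<open>The \<open>SIGMA\<close> form allows a product over pairs to be evaluated as an iterated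
  product; the fibre over \<open>i\<close> has \<open>n - i\<close> elements, which is the weight in
  the definition of \<open>T\<close>.\<close>

abbreviation lt_pairs :: "nat \<Rightarrow> (nat \<times> nat) set"
  where "lt_pairs n \<equiv> SIGMA i:{1..n}. {i<..n}"

text \<open>A pair \<open>i < j\<close> stands for the set of its two entries, and a permutation
  permutes these sets. Sorting the image with \<open>min\<close> and \<open>max\<close> is harmless
  because \<open>f\<close> is symmetric.\<close>

lemma prod_lt_pairs_permute:
  fixes f :: "nat \<Rightarrow> nat \<Rightarrow> 'a::comm_monoid_mult"
  assumes p: "p permutes {1..n}" and sym: "\<And>i j. f i j = f j i"
  shows "(\<Prod>(i, j)\<in>lt_pairs n. f (p i) (p j)) = (\<Prod>(i, j)\<in>lt_pairs n. f i j)"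
proof -
  let ?q = "inv_into UNIV p"
  let ?m = "\<lambda>p (i, j). (min (p i) (p j), max (p i) (p j) :: nat)"
  have q: "?q permutes {1..n}" by (rule permutes_inv[OF p])
  have closed: "?m r ij \<in> lt_pairs n" if r: "r permutes {1..n}" and "ij \<in> lt_pairs n" for r ij
  proof -
    obtain i j where ij: "ij = (i, j)" "i \<in> {1..n}" "j \<in> {1..n}" "i < j"
      using \<open>ij \<in> lt_pairs n\<close> by auto
    have "r i \<in> {1..n}" "r j \<in> {1..n}"
      using ij permutes_in_image[OF r] by blast+
    moreover have "r i \<noteq> r j" using ij(4) permutes_inj[OF r] by (metis injD less_irrefl)
    ultimately show ?thesis using ij(1) by (auto simp: min_def max_def)
  qed
  show ?thesis
  proof (rule prod.reindex_bij_witness[where i = "?m ?q" and j = "?m p"])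
    fix ij assume ij: "ij \<in> lt_pairs n"
    show "?m ?q (?m p ij) = ij" "?m p (?m ?q ij) = ij"
      using ij by (auto simp: min_def max_def permutes_inverses[OF p])
    show "?m p ij \<in> lt_pairs n" "?m ?q ij \<in> lt_pairs n" by (rule closed[OF p ij] closed[OF q ij])+
    show "(case ?m p ij of (i, j) \<Rightarrow> f i j) = (case ij of (i, j) \<Rightarrow> f (p i) (p j))"
      using sym by (auto simp: min_def max_def split: prod.splits)
  qed
qed

text \<open>Non-inversions contribute the factor 1, so the signs of all permutations become products
  over one common index set.\<close>

lemma koszul_sign_pairs:
  "koszul_sign n \<sigma> d = (\<Prod>(i, j)\<in>lt_pairs n. if \<sigma> j < \<sigma> i then (-1) ^ (d i * d j) else 1)"
  unfolding koszul_sign_def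
  by (rule prod.mono_neutral_cong_left) (auto split: if_splits)

lemma permutes_less_cases:
  fixes p :: "nat \<Rightarrow> nat"
  assumes "p permutes S" "i \<noteq> j"
  shows "p i < p j \<or> p j < p i"
  using permutes_inj[OF assms(1)] assms(2) by (metis injD linorder_less_linear)

text \<open>A pair is an inversion of \<open>\<sigma> \<circ> \<rho>\<close> iff exactly one of the
  following holds: \<open>\<rho>\<close> inverts it, or \<open>\<sigma>\<close> inverts its image.
  If both hold, the same sign occurs twice and cancels.\<close>

lemma koszul_sign_compose:
  assumes \<sigma>: "\<sigma> permutes {1..n}" and \<rho>: "\<rho> permutes {1..n}"
  shows "koszul_sign n (\<sigma> \<circ> \<rho>) d
    = koszul_sign n \<sigma> (\<lambda>i. d (inv_into UNIV \<rho> i)) * koszul_sign n \<rho> d"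
proof -
  let ?q = "inv_into UNIV \<rho>"
  \<comment> \<open>The inversion condition for \<open>\<sigma>\<close> is stated for either order
    of \<open>i\<close> and \<open>j\<close>, since reindexing by \<open>\<rho>\<close> needs a
    symmetric function.\<close>
  define f :: "nat \<Rightarrow> nat \<Rightarrow> complex"
    where "f i j = (if i < j \<and> \<sigma> j < \<sigma> i \<or> j < i \<and> \<sigma> i < \<sigma> j
      then (-1) ^ (d (?q i) * d (?q j)) else 1)" for i j
  have f: "f i j = f j i" for i j by (auto simp: f_def mult.commute)
  have "koszul_sign n \<sigma> (\<lambda>i. d (?q i)) = (\<Prod>(i, j)\<in>lt_pairs n. f i j)"
    unfolding koszul_sign_pairs by (rule prod.cong) (auto simp: f_def)
  also have "\<dots> = (\<Prod>(i, j)\<in>lt_pairs n. f (\<rho> i) (\<rho> j))"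
    by (rule prod_lt_pairs_permute[OF \<rho>, symmetric]) (rule f)
  finally have K: "koszul_sign n \<sigma> (\<lambda>i. d (?q i)) = (\<Prod>(i, j)\<in>lt_pairs n. f (\<rho> i) (\<rho> j))" .
  have f\<rho>: "f (\<rho> i) (\<rho> j) = (if \<rho> i < \<rho> j \<and> \<sigma> (\<rho> j) < \<sigma> (\<rho> i) \<or> \<rho> j < \<rho> i \<and> \<sigma> (\<rho> i) < \<sigma> (\<rho> j)
      then (-1) ^ (d i * d j) else 1)" for i j
    by (simp add: f_def permutes_inverses[OF \<rho>])
  have sq: "(-1 :: complex) ^ a * (-1) ^ a = 1" for a by (simp flip: power_mult_distrib)
  show ?thesis
    unfolding K unfolding koszul_sign_pairs prod.distrib[symmetric]
  proof (rule prod.cong, goal_cases)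
    case (2 ij)
    then obtain i j where ij: "ij = (i, j)" "i < j" by auto
    have "\<rho> i < \<rho> j \<or> \<rho> j < \<rho> i" "\<sigma> (\<rho> i) < \<sigma> (\<rho> j) \<or> \<sigma> (\<rho> j) < \<sigma> (\<rho> i)"
      using permutes_less_cases[OF \<rho>, of i j] permutes_less_cases[OF permutes_compose[OF \<rho> \<sigma>], of i j] ij by auto
    then show ?case unfolding ij by (auto simp: f\<rho> sq)
  qed simp
qed

lemma koszul_sign_id [simp]: "koszul_sign n id d = 1"
  unfolding koszul_sign_pairs by (rule prod.neutral) auto

lemma koszul_sign_transpose_1_2:
  assumes "2 \<le> n"
  shows "koszul_sign n (transpose 1 2) (\<lambda>_. 1) = -1"
proof -
  have "{(i, j). i \<in> {1..n} \<and> j \<in> {1..n} \<and> i < j \<and> transpose 1 2 i > transpose 1 2 j} = {(1, 2)}"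
    using assms by (auto simp: transpose_def split: if_splits)
  then show ?thesis unfolding koszul_sign_def by simp
qed

text \<open>With all degrees 1 the sign is multiplicative by \<open>koszul_sign_compose\<close>,
  hence invariant under conjugation; every transposition is conjugate to the one of 1 and 2.\<close>

lemma koszul_sign_transpose:
  assumes "a \<in> {1..n}" "b \<in> {1..n}" "a \<noteq> b"
  shows "koszul_sign n (transpose a b) (\<lambda>_. 1) = -1"
proof -
  have n: "2 \<le> n" using assms by auto
  \<comment> \<open>The conjugating \<open>g\<close> has to send 1 to \<open>a\<close> and 2 to
    \<open>b\<close>. Swapping 1 and \<open>a\<close> settles the first and moves 2 to
    \<open>c\<close>; swapping \<open>c\<close> and \<open>b\<close> then leaves \<open>a\<close>
    fixed.\<close>
  define c where "c = transpose 1 a (2::nat)"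
  define g where "g = transpose c b \<circ> transpose 1 a"
  have c: "c \<in> {1..n}" "c \<noteq> a" "b \<noteq> c \<Longrightarrow> transpose c b a = a"
    using assms n by (auto simp: c_def transpose_def)
  have g: "g permutes {1..n}"
    unfolding g_def using assms c n by (intro permutes_compose permutes_swap_id) auto
  have "g 2 = b" unfolding g_def comp_apply c_def[symmetric] by simp
  moreover have "g 1 = a" using c assms by (cases "b = c") (simp_all add: g_def)
  ultimately have g12: "g 1 = a" "g 2 = b" by simp_all
  then have "inv_into UNIV g a = 1" "inv_into UNIV g b = 2"
    by (simp_all add: permutes_inv_eq[OF g])
  then have "transpose a b \<circ> g = g \<circ> transpose 1 2"
    using transpose_comp_eq[OF permutes_bij[OF g], of a b] by simp
  moreover have "transpose a b permutes {1..n}" "transpose 1 2 permutes {1..n}"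
    using assms n by (auto intro: permutes_swap_id)
  ultimately have "koszul_sign n (transpose a b) (\<lambda>_. 1) * koszul_sign n g (\<lambda>_. 1)
    = koszul_sign n g (\<lambda>_. 1) * koszul_sign n (transpose 1 2) (\<lambda>_. 1)"
    using koszul_sign_compose[OF _ g, of "transpose a b" "\<lambda>_. 1"]
      koszul_sign_compose[OF g, of "transpose 1 2" "\<lambda>_. 1"] by simp
  moreover have "koszul_sign n g (\<lambda>_. 1) \<noteq> 0" by (simp add: koszul_sign_pairs split_def)
  ultimately show ?thesis using koszul_sign_transpose_1_2[OF n] by simp
qed

text \<open>Both sides are multiplicative and equal -1 on transpositions.\<close>

lemma koszul_sign_odd:
  assumes "\<sigma> permutes {1..n}"
  shows "koszul_sign n \<sigma> (\<lambda>_. 1) = of_int (sign \<sigma>)"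
  using assms finite_atLeastAtMost[of 1 n]
proof (induction rule: permutes_induct)
  case id
  show ?case unfolding koszul_sign_id by simp
next
  case (swap a b p)
  have "koszul_sign n (transpose a b \<circ> p) (\<lambda>_. 1)
    = koszul_sign n (transpose a b) (\<lambda>_. 1) * koszul_sign n p (\<lambda>_. 1)"
    using swap by (intro koszul_sign_compose permutes_swap_id)
  moreover have "sign (transpose a b \<circ> p) = sign (transpose a b) * sign p"
    using swap by (intro sign_compose permutation_swap_id) (auto simp: permutation_permutes)
  ultimately show ?case
    using swap by (simp add: koszul_sign_transpose[OF swap(1-3)] sign_swap_id del: One_nat_def o_apply comp_def)
qed

text \<open>The factor \<open>n - i\<close> in the exponent counts the positions to the right of \<open>i\<close>; so both sides
  are products over pairs of positions and can be compared pair by pair.\<close>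

lemma koszul_sign_twist:
  assumes \<sigma>: "\<sigma> permutes {1..n}" and d: "\<And>i. i \<in> {1..n} \<Longrightarrow> d i \<in> {0, 1}"
  shows "koszul_sign n \<sigma> d * (-1) ^ (\<Sum>i=1..n. (n - i) * d (inv_into UNIV \<sigma> i))
    = of_int (sign \<sigma>) * koszul_sign n \<sigma> (\<lambda>i. 1 - d i) * (-1) ^ (\<Sum>i=1..n. (n - i) * d i)"
proof -
  let ?q = "inv_into UNIV \<sigma>"
  have weight: "(-1) ^ (\<Sum>i=1..n. (n - i) * e i) = (\<Prod>(i, j)\<in>lt_pairs n. (-1 :: complex) ^ e i)"
    for e :: "nat \<Rightarrow> nat"
    by (subst prod.Sigma[symmetric]) (auto simp: power_sum power_mult mult.commute)
  \<comment> \<open>For \<open>i < j\<close> the weight belongs to the left position. Writing it as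
    \<open>min i j\<close> makes the factor symmetric, so that the product can be reindexed by
    \<open>\<sigma>\<close>.\<close>
  have "(-1) ^ (\<Sum>i=1..n. (n - i) * d (?q i))
    = (\<Prod>(i, j)\<in>lt_pairs n. (-1 :: complex) ^ d (?q (min i j)))"
    unfolding weight by (rule prod.cong) (auto simp: min_def)
  also have "\<dots> = (\<Prod>(i, j)\<in>lt_pairs n. (-1) ^ d (?q (min (\<sigma> i) (\<sigma> j))))"
    by (rule prod_lt_pairs_permute[OF \<sigma>, symmetric]) (simp add: min.commute)
  finally have K: "(-1) ^ (\<Sum>i=1..n. (n - i) * d (?q i))
    = (\<Prod>(i, j)\<in>lt_pairs n. (-1 :: complex) ^ d (?q (min (\<sigma> i) (\<sigma> j))))" .
  show ?thesis
    unfolding koszul_sign_odd[OF \<sigma>, symmetric] koszul_sign_pairs K weight prod.distrib[symmetric]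
  proof (rule prod.cong, goal_cases)
    case (2 ij)
    then obtain i j where ij: "ij = (i, j)" "i \<in> {1..n}" "j \<in> {1..n}" "i < j" by auto
    \<comment> \<open>Without an inversion the two factors agree at once. For an inverted pair with
      degrees \<open>a\<close> and \<open>b\<close> the claim is that \<open>a * b + b\<close> and
      \<open>1 + (1 - a) * (1 - b) + a\<close> have the same parity.\<close>
    have "\<sigma> i < \<sigma> j \<or> \<sigma> j < \<sigma> i" using permutes_less_cases[OF \<sigma>, of i j] ij by auto
    then show ?case
      using d[OF ij(2)] d[OF ij(3)] unfolding ij by (auto simp: min_def permutes_inverses[OF \<sigma>])
  qed simp
qed

section \<open>Operators twisting a permutation action by the sign\<close>

text \<open>These relations are all that the isomorphism uses of the grading. They will be
  instantiated with \<open>U = s T\<close>, where the scalar \<open>s\<close> turns \<open>T\<close>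
  into an involution.\<close>

locale sign_twist = vector_space sW
  for sW :: "complex \<Rightarrow> 'w::ab_group_add \<Rightarrow> 'w" +
  fixes n :: nat and \<phi> :: "(nat \<Rightarrow> nat) \<Rightarrow> 'w \<Rightarrow> 'w" and U :: "'w \<Rightarrow> 'w"
  assumes n: "2 \<le> n"
    and \<phi>_linear: "\<sigma> permutes {1..n} \<Longrightarrow> Vector_Spaces.linear sW sW (\<phi> \<sigma>)"
    and \<phi>_id: "\<phi> id = id"
    and \<phi>_comp: "\<sigma> permutes {1..n} \<Longrightarrow> \<rho> permutes {1..n} \<Longrightarrow> \<phi> (\<sigma> \<circ> \<rho>) = \<phi> \<sigma> \<circ> \<phi> \<rho>"
    and U_linear: "Vector_Spaces.linear sW sW U"
    and U_U [simp]: "U (U x) = x"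
    and U_\<phi>: "\<sigma> permutes {1..n} \<Longrightarrow> U (\<phi> \<sigma> x) = sW (of_int (sign \<sigma>)) (\<phi> \<sigma> (U x))"
begin

abbreviation "alt_alg \<equiv> commutant_algebra sW (\<phi> ` carrier (alt_group n))"
abbreviation "sym_alg \<equiv> commutant_algebra sW (\<phi> ` carrier (sym_group n))"

lemma sym_alg_iff:
  "b \<in> carrier sym_alg \<longleftrightarrow> Vector_Spaces.linear sW sW b \<and>
    (\<forall>\<sigma>. \<sigma> permutes {1..n} \<longrightarrow> (\<forall>x. b (\<phi> \<sigma> x) = \<phi> \<sigma> (b x)))"
  by (auto simp: commutant_algebra_def sym_group_carrier fun_eq_iff)

lemma alt_alg_iff:
  "b \<in> carrier alt_alg \<longleftrightarrow> Vector_Spaces.linear sW sW b \<and>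
    (\<forall>\<sigma>. \<sigma> permutes {1..n} \<longrightarrow> evenperm \<sigma> \<longrightarrow> (\<forall>x. b (\<phi> \<sigma> x) = \<phi> \<sigma> (b x)))"
  by (auto simp: commutant_algebra_def alt_group_carrier fun_eq_iff)

lemma linearD:
  assumes "Vector_Spaces.linear sW sW f"
  shows "f (x + y) = f x + f y" "f (sW c x) = sW c (f x)" "f (- x) = - f x" "f (x - y) = f x - f y"
proof -
  show a: "f (x + y) = f x + f y" "f (sW c x) = sW c (f x)" for x y c
    using assms unfolding Vector_Spaces.linear_iff by auto
  show m: "f (- x) = - f x" for x using a(2)[of "-1" x] by simp
  show "f (x - y) = f x - f y" using a(1)[of x "-y"] m by simp
qed

lemmas U_lin = linearD[OF U_linear]
lemmas \<phi>_lin = linearD[OF \<phi>_linear]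

lemma sign_square: "(of_int (sign \<sigma>) :: complex) * of_int (sign \<sigma>) = 1"
  by (simp flip: of_int_mult)

lemma half_double: "sW (1/2) (x + x) = x"
  by (simp add: scale_right_distrib flip: scale_left_distrib)

text \<open>A permutation passes \<open>U\<close> twice, so the sign appears squared.\<close>

lemma conj_U_closed:
  assumes "b \<in> carrier sym_alg"
  shows "U \<circ> b \<circ> U \<in> carrier sym_alg"
  using assms unfolding sym_alg_iff
  by (auto simp: U_\<phi> U_lin linearD \<phi>_lin sign_square intro!: Vector_Spaces.linear_compose[of _ sW] U_linear)

lemma mult_U_closed:
  assumes "b \<in> carrier sym_alg"
  shows "b \<circ> U \<in> carrier alt_alg"
  using assms unfolding sym_alg_iff alt_alg_iff
  by (auto simp: U_\<phi> linearD sign_def intro!: Vector_Spaces.linear_compose[of _ sW] U_linear)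

lemma sym_alg_subset: "b \<in> carrier sym_alg \<Longrightarrow> b \<in> carrier alt_alg"
  unfolding sym_alg_iff alt_alg_iff by blast

text \<open>The decomposition comes from splitting \<open>a\<close> into its two eigenvectors under conjugation with
  an odd permutation.\<close>

lemma alt_alg_decomposition:
  assumes a: "a \<in> carrier alt_alg"
  obtains b c where "b \<in> carrier sym_alg" "c \<in> carrier sym_alg" "a = (\<lambda>x. b x + c (U x))"
proof -
  define p :: "nat \<Rightarrow> nat" where "p = transpose 1 2"
  define P where "P = \<phi> p"
  have p: "p permutes {1..n}" using n unfolding p_def by (intro permutes_swap_id) auto
  have pp: "p \<circ> p = id" by (simp add: p_def fun_eq_iff)
  have sp: "sign p = -1" by (simp add: p_def sign_swap_id)
  have perm: "permutation \<sigma>" if "\<sigma> permutes {1..n}" for \<sigma> :: "nat \<Rightarrow> nat"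
    using that by (auto simp: permutation_permutes)
  have PP [simp]: "P (P x) = x" for x
    using fun_cong[OF \<phi>_comp[OF p p], of x] \<phi>_id unfolding pp P_def by simp
  have P: "Vector_Spaces.linear sW sW P" unfolding P_def by (rule \<phi>_linear[OF p])
  note P_lin = linearD[OF P]
  have UP: "U (P x) = - P (U x)" for x using U_\<phi>[OF p] by (simp add: P_def sp)
  have al: "Vector_Spaces.linear sW sW a" using a alt_alg_iff by blast
  note a_lin = linearD[OF al]
  have even: "sign \<sigma> = 1 \<longleftrightarrow> evenperm \<sigma>" for \<sigma> :: "nat \<Rightarrow> nat" by (simp add: sign_def)
  have a_even: "a (\<phi> \<sigma> x) = \<phi> \<sigma> (a x)" if "\<sigma> permutes {1..n}" "sign \<sigma> = 1" for \<sigma> x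
    using a that unfolding alt_alg_iff even by blast
  \<comment> \<open>Conjugation with \<open>p\<close> preserves evenness, so \<open>P a P\<close>
    again commutes with the even permutations.\<close>
  have conj: "P (a (P (\<phi> \<sigma> x))) = \<phi> \<sigma> (P (a (P x)))" if \<sigma>: "\<sigma> permutes {1..n}" "sign \<sigma> = 1" for \<sigma> x
  proof -
    let ?\<rho> = "p \<circ> \<sigma> \<circ> p"
    have \<rho>: "?\<rho> permutes {1..n}" using p \<sigma> by (intro permutes_compose)
    have "sign ?\<rho> = sign p * sign \<sigma> * sign p"
      using perm[OF p] perm[OF \<sigma>(1)] by (simp only: sign_compose permutation_compose)
    then have "sign ?\<rho> = 1" using \<sigma>(2) by (simp add: sp)
    then have "P (a (\<phi> ?\<rho> (P x))) = P (\<phi> ?\<rho> (a (P x)))" by (simp only: a_even[OF \<rho>])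
    moreover have "\<phi> ?\<rho> = P \<circ> \<phi> \<sigma> \<circ> P"
      using p \<sigma>(1) by (simp only: \<phi>_comp permutes_compose P_def)
    ultimately show ?thesis by simp
  qed
  \<comment> \<open>An odd \<open>\<sigma>\<close> is the even permutation
    \<open>\<sigma> \<circ> p\<close> followed on the right by \<open>p\<close>. Commutation
    therefore has to be checked only for even permutations and for \<open>P\<close>.\<close>
  have odd: "\<phi> \<sigma> x = \<phi> (\<sigma> \<circ> p) (P x)" if "\<sigma> permutes {1..n}" for \<sigma> x
    using \<phi>_comp[OF that p] by (simp add: P_def[symmetric])
  have sodd: "sign (\<sigma> \<circ> p) = 1" "\<sigma> \<circ> p permutes {1..n}"
    if "\<sigma> permutes {1..n}" "sign \<sigma> \<noteq> 1" for \<sigma>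
  proof -
    have "sign (\<sigma> \<circ> p) = sign \<sigma> * sign p"
      by (rule sign_compose) (use that p perm in blast)+
    then show "sign (\<sigma> \<circ> p) = 1" using that(2) sp by (cases \<sigma> rule: sign_cases) auto
    show "\<sigma> \<circ> p permutes {1..n}" by (rule permutes_compose[OF p that(1)])
  qed
  \<comment> \<open>These are the components of \<open>a\<close> for the eigenvalues 1 and -1 of the
    involution sending \<open>a\<close> to \<open>P a P\<close>.\<close>
  define b where "b x = sW (1/2) (a x + P (a (P x)))" for x
  define c' where "c' x = sW (1/2) (a x - P (a (P x)))" for x
  have b: "b (\<phi> \<sigma> x) = \<phi> \<sigma> (b x)" if \<sigma>: "\<sigma> permutes {1..n}" for \<sigma> x
  proof (cases "sign \<sigma> = 1")
    case True
    then show ?thesis by (simp add: b_def a_even[OF \<sigma>] conj[OF \<sigma>] \<phi>_lin[OF \<sigma>])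
  next
    case False
    note r = sodd[OF \<sigma> False]
    show ?thesis unfolding odd[OF \<sigma>]
      by (simp add: b_def a_even[OF r(2,1)] conj[OF r(2,1)] \<phi>_lin[OF r(2)] P_lin add.commute del: comp_def)
  qed
  have c': "c' (\<phi> \<sigma> x) = sW (of_int (sign \<sigma>)) (\<phi> \<sigma> (c' x))" if \<sigma>: "\<sigma> permutes {1..n}" for \<sigma> x
  proof (cases "sign \<sigma> = 1")
    case True
    then show ?thesis by (simp add: c'_def a_even[OF \<sigma>] conj[OF \<sigma>] \<phi>_lin[OF \<sigma>])
  next
    case False
    then have s: "sign \<sigma> = -1" using sign_cases[of \<sigma>] by blast
    note r = sodd[OF \<sigma> False]
    show ?thesis unfolding odd[OF \<sigma>] s
      by (simp add: c'_def a_even[OF r(2,1)] conj[OF r(2,1)] \<phi>_lin[OF r(2)] P_lin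
          scale_right_diff_distrib del: comp_def)
  qed
  \<comment> \<open>Both \<open>c'\<close> and \<open>U\<close> twist by the sign, so
    \<open>c' \<circ> U\<close> commutes with all permutations, and a further factor
    \<open>U\<close> gives back \<open>c'\<close>.\<close>
  show ?thesis
  proof (rule that[of b "c' \<circ> U"])
    show "b \<in> carrier sym_alg"
      using b al P vector_space_axioms unfolding sym_alg_iff Vector_Spaces.linear_iff
      by (auto simp: b_def algebra_simps)
    have "Vector_Spaces.linear sW sW c'"
      using al P vector_space_axioms unfolding Vector_Spaces.linear_iff
      by (auto simp: c'_def algebra_simps)
    moreover from this have "c' (U (\<phi> \<sigma> x)) = \<phi> \<sigma> (c' (U x))" if "\<sigma> permutes {1..n}" for \<sigma> x
      using that by (simp add: U_\<phi> c' linearD sign_square)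
    ultimately show "c' \<circ> U \<in> carrier sym_alg"
      unfolding sym_alg_iff by (auto intro!: Vector_Spaces.linear_compose[of _ sW] U_linear)
    show "a = (\<lambda>x. b x + (c' \<circ> U) (U x))"
      by (simp add: b_def c'_def fun_eq_iff half_double flip: scale_right_distrib)
  qed
qed

text \<open>Conjugation with a transposition fixes the first summand and negates the second. Adding
  the original and the conjugated equation isolates \<open>b\<close>; then \<open>c\<close> follows
  since \<open>U\<close> is invertible.\<close>

lemma alt_alg_decomposition_unique:
  assumes mem: "b \<in> carrier sym_alg" "c \<in> carrier sym_alg" "b' \<in> carrier sym_alg" "c' \<in> carrier sym_alg"
    and eq: "\<And>x. b x + c (U x) = b' x + c' (U x)"
  shows "b = b'" "c = c'"
proof -
  define p :: "nat \<Rightarrow> nat" where "p = transpose 1 2"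
  have p: "p permutes {1..n}" using n unfolding p_def by (intro permutes_swap_id) auto
  have sp: "sign p = -1" by (simp add: p_def sign_swap_id)
  have pp: "\<phi> p (\<phi> p x) = x" for x
    using fun_cong[OF \<phi>_comp[OF p p], of x] \<phi>_id by (simp add: p_def id_def)
  have comm: "f (\<phi> p x) = \<phi> p (f x)" if "f \<in> carrier sym_alg" for f x
    using that p sym_alg_iff by blast
  have lin: "Vector_Spaces.linear sW sW f" if "f \<in> carrier sym_alg" for f
    using that sym_alg_iff by blast
  have "b x - c (U x) = b' x - c' (U x)" for x
    using arg_cong[OF eq[of "\<phi> p x"], of "\<phi> p"] mem
    by (simp add: comm \<phi>_lin[OF p] U_\<phi>[OF p] sp linearD[OF lin] pp)
  then have "(b x + c (U x)) + (b x - c (U x)) = (b' x + c' (U x)) + (b' x - c' (U x))" for x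
    by (simp only: eq)
  then have "b x + b x = b' x + b' x" for x by (simp add: algebra_simps)
  then have bb: "b x = b' x" for x by (metis half_double)
  then show "b = b'" by blast
  have "c x = c' x" for x using eq[of "U x"] bb by simp
  then show "c = c'" by blast
qed

end

section \<open>Crossed products with a group of order two\<close>

lemma algebra_iso_trans:
  assumes "f \<in> algebra_iso R S" "h \<in> algebra_iso S Q"
  shows "h \<circ> f \<in> algebra_iso R Q"
  using assms ring_iso_set_trans[of f R S h Q]
  unfolding algebra_iso_def algebra_linear_def by (auto simp: Pi_iff)

text \<open>Preimages are identified by injectivity on the carrier, which is why each operation has
  to stay inside it.\<close>

lemma algebra_iso_inv_into:
  assumes h: "h \<in> algebra_iso R S"
    and closed: "\<And>x y. x \<in> carrier R \<Longrightarrow> y \<in> carrier R \<Longrightarrow> x \<oplus>\<^bsub>R\<^esub> y \<in> carrier R"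
      "\<And>x y. x \<in> carrier R \<Longrightarrow> y \<in> carrier R \<Longrightarrow> x \<otimes>\<^bsub>R\<^esub> y \<in> carrier R"
      "\<And>c x. x \<in> carrier R \<Longrightarrow> c \<odot>\<^bsub>R\<^esub> x \<in> carrier R" "\<one>\<^bsub>R\<^esub> \<in> carrier R"
  shows "inv_into (carrier R) h \<in> algebra_iso S R"
proof -
  let ?k = "inv_into (carrier R) h"
  have bij: "bij_betw h (carrier R) (carrier S)"
    and hom: "h \<in> ring_hom R S" and lin: "h \<in> algebra_linear R S"
    using h by (auto simp: algebra_iso_def ring_iso_def)
  have bijk: "bij_betw ?k (carrier S) (carrier R)" by (rule bij_betw_inv_into[OF bij])
  have k: "?k y \<in> carrier R" "h (?k y) = y" if "y \<in> carrier S" for y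
    using that bij bij_betwE[OF bijk] by (auto simp: bij_betw_inv_into_right)
  have kh: "?k y = x" if "x \<in> carrier R" "h x = y" for x y
    using that bij by (metis bij_betw_inv_into_left)
  have hc: "\<And>c x. x \<in> carrier R \<Longrightarrow> h (c \<odot>\<^bsub>R\<^esub> x) = c \<odot>\<^bsub>S\<^esub> h x"
    using lin by (auto simp: algebra_linear_def)
  have "?k (x \<oplus>\<^bsub>S\<^esub> y) = ?k x \<oplus>\<^bsub>R\<^esub> ?k y" "?k (x \<otimes>\<^bsub>S\<^esub> y) = ?k x \<otimes>\<^bsub>R\<^esub> ?k y"
    if "x \<in> carrier S" "y \<in> carrier S" for x y
    using that k by (auto intro!: kh closed simp: ring_hom_add[OF hom] ring_hom_mult[OF hom])
  moreover have "?k (c \<odot>\<^bsub>S\<^esub> x) = c \<odot>\<^bsub>R\<^esub> ?k x" if "x \<in> carrier S" for c x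
    using that k by (auto intro!: kh closed simp: hc)
  moreover have "?k \<one>\<^bsub>S\<^esub> = \<one>\<^bsub>R\<^esub>" by (rule kh[OF closed(4) ring_hom_one[OF hom]])
  ultimately show ?thesis
    using k bijk by (auto simp: algebra_iso_def algebra_linear_def intro!: ring_iso_memI)
qed

lemma crossed_product_closed:
  assumes R: "ring R" and smult: "\<And>c x. x \<in> carrier R \<Longrightarrow> c \<odot>\<^bsub>R\<^esub> x \<in> carrier R"
    and G: "group G" and \<alpha>: "\<And>g. g \<in> carrier G \<Longrightarrow> \<alpha> g \<in> carrier R \<rightarrow> carrier R"
  defines "P \<equiv> crossed_product R G \<alpha>"
  shows "x \<in> carrier P \<Longrightarrow> y \<in> carrier P \<Longrightarrow> x \<oplus>\<^bsub>P\<^esub> y \<in> carrier P"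
    and "x \<in> carrier P \<Longrightarrow> y \<in> carrier P \<Longrightarrow> x \<otimes>\<^bsub>P\<^esub> y \<in> carrier P"
    and "x \<in> carrier P \<Longrightarrow> c \<odot>\<^bsub>P\<^esub> x \<in> carrier P" and "\<one>\<^bsub>P\<^esub> \<in> carrier P"
proof -
  interpret R: ring R by fact
  interpret G: group G by fact
  show "x \<in> carrier P \<Longrightarrow> y \<in> carrier P \<Longrightarrow> x \<oplus>\<^bsub>P\<^esub> y \<in> carrier P"
    "x \<in> carrier P \<Longrightarrow> c \<odot>\<^bsub>P\<^esub> x \<in> carrier P" "\<one>\<^bsub>P\<^esub> \<in> carrier P"
    by (auto simp: P_def crossed_product_def pure_tensor_def PiE_iff smult)
  show "x \<otimes>\<^bsub>P\<^esub> y \<in> carrier P" if "x \<in> carrier P" "y \<in> carrier P"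
    using that \<alpha> by (auto simp: P_def crossed_product_def PiE_iff Pi_iff intro!: R.finsum_closed)
qed

text \<open>In a group of order two each element has exactly two factorizations, so every
  convolution sum has two terms.\<close>

lemma crossed_product_mult_two:
  fixes G (structure)
  assumes R: "ring R" and G: "group G" and G2: "carrier G = {\<one>, g}" "g \<noteq> \<one>"
    and \<alpha>: "\<And>g. g \<in> carrier G \<Longrightarrow> \<alpha> g \<in> carrier R \<rightarrow> carrier R"
    and f: "f \<in> carrier (crossed_product R G \<alpha>)" "f' \<in> carrier (crossed_product R G \<alpha>)"
  shows "(f \<otimes>\<^bsub>crossed_product R G \<alpha>\<^esub> f') \<one>
      = f \<one> \<otimes>\<^bsub>R\<^esub> \<alpha> \<one> (f' \<one>) \<oplus>\<^bsub>R\<^esub> f g \<otimes>\<^bsub>R\<^esub> \<alpha> g (f' g)"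
    and "(f \<otimes>\<^bsub>crossed_product R G \<alpha>\<^esub> f') g
      = f \<one> \<otimes>\<^bsub>R\<^esub> \<alpha> \<one> (f' g) \<oplus>\<^bsub>R\<^esub> f g \<otimes>\<^bsub>R\<^esub> \<alpha> g (f' \<one>)"
proof -
  interpret R: ring R by fact
  interpret G: group G by fact
  have g: "g \<in> carrier G" using G2 by simp
  \<comment> \<open>The other possibility \<open>g \<otimes> g = g\<close> would give
    \<open>g = \<one>\<close> by cancellation.\<close>
  have gg: "g \<otimes> g = \<one>"
    using G2 G.m_closed[of g g] G.l_cancel_one[of g g] by auto
  have pairs: "{(a, b). a \<in> carrier G \<and> b \<in> carrier G \<and> a \<otimes> b = \<one>} = {(\<one>, \<one>), (g, g)}"
    "{(a, b). a \<in> carrier G \<and> b \<in> carrier G \<and> a \<otimes> b = g} = {(\<one>, g), (g, \<one>)}"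
    using G2 gg by auto
  have cl: "f a \<otimes>\<^bsub>R\<^esub> \<alpha> a (f' b) \<in> carrier R" if "a \<in> carrier G" "b \<in> carrier G" for a b
    using \<alpha>[OF that(1)] f that by (auto simp: crossed_product_def PiE_iff)
  have sum: "finsum R (\<lambda>(a, b). f a \<otimes>\<^bsub>R\<^esub> \<alpha> a (f' b)) {(a, b), (a', b')}
      = f a \<otimes>\<^bsub>R\<^esub> \<alpha> a (f' b) \<oplus>\<^bsub>R\<^esub> f a' \<otimes>\<^bsub>R\<^esub> \<alpha> a' (f' b')"
    if "a \<in> carrier G" "b \<in> carrier G" "a' \<in> carrier G" "b' \<in> carrier G" "a \<noteq> a'" for a b a' b'
    using cl[of a b] cl[of a' b'] that by simp
  show "(f \<otimes>\<^bsub>crossed_product R G \<alpha>\<^esub> f') \<one>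
      = f \<one> \<otimes>\<^bsub>R\<^esub> \<alpha> \<one> (f' \<one>) \<oplus>\<^bsub>R\<^esub> f g \<otimes>\<^bsub>R\<^esub> \<alpha> g (f' g)"
    unfolding sum[symmetric, OF G.one_closed G.one_closed g g G2(2)[symmetric]] pairs(1)[symmetric]
    by (simp add: crossed_product_def)
  show "(f \<otimes>\<^bsub>crossed_product R G \<alpha>\<^esub> f') g
      = f \<one> \<otimes>\<^bsub>R\<^esub> \<alpha> \<one> (f' g) \<oplus>\<^bsub>R\<^esub> f g \<otimes>\<^bsub>R\<^esub> \<alpha> g (f' \<one>)"
    unfolding sum[symmetric, OF G.one_closed g g G.one_closed G2(2)[symmetric]] pairs(2)[symmetric]
    using g by (simp add: crossed_product_def)
qed

text \<open>Linearity of the operators in \<open>S\<close> gives closure of the commutant under sums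
  and negation.\<close>

lemma commutant_algebra_ring:
  assumes W: "vector_space sW" and S: "\<And>g. g \<in> S \<Longrightarrow> Vector_Spaces.linear sW sW g"
  shows "ring (commutant_algebra sW S)" (is "ring ?R")
proof -
  interpret vector_space sW by fact
  have mem: "b \<in> carrier ?R \<longleftrightarrow> Vector_Spaces.linear sW sW b \<and> (\<forall>g\<in>S. \<forall>x. b (g x) = g (b x))" for b
    by (auto simp: commutant_algebra_def fun_eq_iff)
  interpret WW: vector_space_pair sW sW ..
  have ops: "f \<oplus>\<^bsub>?R\<^esub> h = (\<lambda>x. f x + h x)" "f \<otimes>\<^bsub>?R\<^esub> h = (\<lambda>x. f (h x))"
      "\<zero>\<^bsub>?R\<^esub> = (\<lambda>_. 0)" "\<one>\<^bsub>?R\<^esub> = (\<lambda>x. x)" for f h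
    by (auto simp: commutant_algebra_def)
  show ?thesis
  proof (intro ringI abelian_groupI monoidI)
    fix x assume x: "x \<in> carrier ?R"
    have "(\<lambda>w. - x w) \<in> carrier ?R"
      using x S unfolding mem by (simp add: WW.linear_compose_neg WW.linear_neg)
    then show "\<exists>y\<in>carrier ?R. y \<oplus>\<^bsub>?R\<^esub> x = \<zero>\<^bsub>?R\<^esub>" by (rule bexI[rotated]) (simp add: ops)
  next
    fix x y assume xy: "x \<in> carrier ?R" "y \<in> carrier ?R"
    show "x \<oplus>\<^bsub>?R\<^esub> y \<in> carrier ?R"
      using xy S unfolding mem ops by (simp add: WW.linear_compose_add WW.linear_add)
    show "x \<otimes>\<^bsub>?R\<^esub> y \<in> carrier ?R"
      using xy Vector_Spaces.linear_compose[of sW sW y sW x] unfolding mem ops by (simp add: comp_def)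
  next
    fix x y z assume "z \<in> carrier ?R"
    then show "z \<otimes>\<^bsub>?R\<^esub> (x \<oplus>\<^bsub>?R\<^esub> y) = z \<otimes>\<^bsub>?R\<^esub> x \<oplus>\<^bsub>?R\<^esub> z \<otimes>\<^bsub>?R\<^esub> y"
      unfolding mem ops by (simp add: WW.linear_add)
  qed (use S in \<open>simp_all add: mem ops add_ac WW.linear_0 WW.linear_zero linear_ident\<close>)
qed

section \<open>The crossed product as the commutant of the alternating group\<close>

context sign_twist
begin

lemma sym_alg_ring: "ring sym_alg"
  by (rule commutant_algebra_ring[OF vector_space_axioms]) (auto simp: sym_group_carrier \<phi>_linear)

lemma sym_alg_smult:
  assumes "b \<in> carrier sym_alg"
  shows "c \<odot>\<^bsub>sym_alg\<^esub> b \<in> carrier sym_alg"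
proof -
  interpret WW: vector_space_pair sW sW ..
  show ?thesis
    using assms unfolding sym_alg_iff
    by (simp add: commutant_algebra_def \<phi>_lin WW.linear_compose_scale_right)
qed

text \<open>Bijectivity is existence and uniqueness of the decomposition \<open>b + c U\<close>. The
  group is an arbitrary one of order two, so that the result covers both the group generated by the
  automorphism and the integers modulo 2.\<close>

lemma crossed_product_iso_alt_alg:
  fixes G (structure)
  assumes G: "group G" and G2: "carrier G = {\<one>, g}" "g \<noteq> \<one>"
    and \<alpha>1: "\<And>b. b \<in> carrier sym_alg \<Longrightarrow> \<alpha> \<one> b = b"
    and \<alpha>g: "\<And>b. b \<in> carrier sym_alg \<Longrightarrow> \<alpha> g b = U \<circ> b \<circ> U"
  shows "(\<lambda>f x. f \<one> x + f g (U x)) \<in> algebra_iso (crossed_product sym_alg G \<alpha>) alt_alg"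
    and "algebra_iso alt_alg (crossed_product sym_alg G \<alpha>) \<noteq> {}"
proof -
  let ?P = "crossed_product sym_alg G \<alpha>"
  let ?Z = "\<lambda>f x. f \<one> x + f g (U x)"
  have \<alpha>: "\<alpha> h \<in> carrier sym_alg \<rightarrow> carrier sym_alg" if "h \<in> carrier G" for h
    using that G2 \<alpha>1 \<alpha>g conj_U_closed by auto
  have mem: "f \<one> \<in> carrier sym_alg" "f g \<in> carrier sym_alg" "f \<in> extensional {\<one>, g}"
    if "f \<in> carrier ?P" for f
    using that G2 by (auto simp: crossed_product_def PiE_iff)
  have lin: "Vector_Spaces.linear sW sW b" if "b \<in> carrier sym_alg" for b
    using that sym_alg_iff by blast
  have add: "?Z (f \<oplus>\<^bsub>?P\<^esub> f') = ?Z f \<oplus>\<^bsub>alt_alg\<^esub> ?Z f'"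
    if "f \<in> carrier ?P" "f' \<in> carrier ?P" for f f'
    using G2 by (simp add: crossed_product_def commutant_algebra_def algebra_simps)
  have smult: "?Z (c \<odot>\<^bsub>?P\<^esub> f) = c \<odot>\<^bsub>alt_alg\<^esub> ?Z f" if "f \<in> carrier ?P" for c f
    using G2 by (simp add: crossed_product_def commutant_algebra_def scale_right_distrib)
  have closed: "?Z f \<in> carrier alt_alg" if "f \<in> carrier ?P" for f
  proof -
    have "f \<one> \<in> carrier alt_alg" "f g \<circ> U \<in> carrier alt_alg"
      using mem[OF that] sym_alg_subset mult_U_closed by auto
    then show ?thesis
      unfolding alt_alg_iff using vector_space_axioms
      by (auto simp: \<phi>_lin Vector_Spaces.linear_iff scale_right_distrib algebra_simps)
  qed
  have mult': "?Z (f \<otimes>\<^bsub>?P\<^esub> f') = ?Z f \<otimes>\<^bsub>alt_alg\<^esub> ?Z f'"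
    if f: "f \<in> carrier ?P" "f' \<in> carrier ?P" for f f'
  proof -
    have ops: "b \<oplus>\<^bsub>sym_alg\<^esub> c = (\<lambda>x. b x + c x)" "b \<otimes>\<^bsub>sym_alg\<^esub> c = (\<lambda>x. b (c x))"
      "b \<otimes>\<^bsub>alt_alg\<^esub> c = (\<lambda>x. b (c x))" for b c
      by (auto simp: commutant_algebra_def)
    note m = mem[OF f(1)] mem[OF f(2)]
    \<comment> \<open>Moving \<open>U\<close> to the right past \<open>b\<close> gives
      \<open>U b = (U b U) U\<close>, which is the twist by \<open>\<alpha> g\<close>; two factors
      \<open>U\<close> cancel and contribute to the coefficient at \<open>\<one>\<close>.\<close>
    have "(f \<otimes>\<^bsub>?P\<^esub> f') \<one> = f \<one> \<otimes>\<^bsub>sym_alg\<^esub> \<alpha> \<one> (f' \<one>) \<oplus>\<^bsub>sym_alg\<^esub> f g \<otimes>\<^bsub>sym_alg\<^esub> \<alpha> g (f' g)"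
      "(f \<otimes>\<^bsub>?P\<^esub> f') g = f \<one> \<otimes>\<^bsub>sym_alg\<^esub> \<alpha> \<one> (f' g) \<oplus>\<^bsub>sym_alg\<^esub> f g \<otimes>\<^bsub>sym_alg\<^esub> \<alpha> g (f' \<one>)"
      using crossed_product_mult_two[OF sym_alg_ring G G2 _ f] \<alpha> by blast+
    then show ?thesis
      unfolding ops using m by (simp add: \<alpha>1 \<alpha>g fun_eq_iff linearD[OF lin] U_lin add_ac)
  qed
  have one: "?Z \<one>\<^bsub>?P\<^esub> = \<one>\<^bsub>alt_alg\<^esub>"
    using G2 by (auto simp: crossed_product_def pure_tensor_def commutant_algebra_def)
  have "inj_on ?Z (carrier ?P)"
  proof
    fix f f' assume f: "f \<in> carrier ?P" "f' \<in> carrier ?P" and eq: "?Z f = ?Z f'"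
    note m = mem[OF f(1)] mem[OF f(2)]
    have "f \<one> = f' \<one>" "f g = f' g"
      using alt_alg_decomposition_unique[OF m(1,2,4,5)] fun_cong[OF eq] by blast+
    then show "f = f'" by (intro extensionalityI[OF m(3,6)]) auto
  qed
  moreover have "\<exists>f\<in>carrier ?P. ?Z f = a" if a: "a \<in> carrier alt_alg" for a
  proof -
    obtain b c where bc: "b \<in> carrier sym_alg" "c \<in> carrier sym_alg" "a = (\<lambda>x. b x + c (U x))"
      using alt_alg_decomposition[OF a] by blast
    then show ?thesis
      using G2 by (intro bexI[of _ "\<lambda>h\<in>carrier G. if h = \<one> then b else c"])
        (auto simp: crossed_product_def)
  qed
  ultimately have "bij_betw ?Z (carrier ?P) (carrier alt_alg)"
    using closed by (auto simp: bij_betw_def image_iff)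
  then show Z: "?Z \<in> algebra_iso ?P alt_alg"
    using closed add mult' one smult
    by (auto simp: algebra_iso_def algebra_linear_def intro!: ring_iso_memI)
  show "algebra_iso alt_alg ?P \<noteq> {}"
  proof -
    note closed = crossed_product_closed[of sym_alg G \<alpha>, OF sym_alg_ring _ G]
    have "inv_into (carrier ?P) ?Z \<in> algebra_iso alt_alg ?P"
      by (rule algebra_iso_inv_into[OF Z]; rule closed) (use sym_alg_smult \<alpha> in blast)+
    then show ?thesis by blast
  qed
qed

end

section \<open>The operator T on a graded tensor power\<close>

lemma linear_zero:
  assumes "Vector_Spaces.linear sV sW F"
  shows "F 0 = 0"
proof -
  have "F (0 + 0) = F 0 + F 0" using assms unfolding Vector_Spaces.linear_iff by blast
  then show ?thesis by simp
qed

locale graded_tensor_power =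
  fixes n :: nat and sV :: "complex \<Rightarrow> 'v::ab_group_add \<Rightarrow> 'v"
    and sW :: "complex \<Rightarrow> 'w::ab_group_add \<Rightarrow> 'w" and tens :: "(nat \<Rightarrow> 'v) \<Rightarrow> 'w"
    and V0 V1 :: "'v set"
  assumes tp: "is_tensor_power n sV sW tens" and gr: "is_graded_space sV V0 V1"
begin

sublocale V: vector_space sV using tp by (simp add: is_tensor_power_def)
sublocale W: vector_space sW using tp by (simp add: is_tensor_power_def)

text \<open>Zero is excluded because it has degree 0 and is fixed by the linear map
  \<open>\<tau>\<close>, so it would violate the exchange of degrees in
  \<open>hdeg_\<tau>\<close>.\<close>

abbreviation homog :: "(nat \<Rightarrow> 'v) \<Rightarrow> bool"
  where "homog v \<equiv> \<forall>i\<in>{1..n}. v i \<in> (V0 \<union> V1) - {0}"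

lemma linear_eqI_homog:
  assumes F: "Vector_Spaces.linear sW sX F" and G: "Vector_Spaces.linear sW sX G"
    and eq: "\<And>v. homog v \<Longrightarrow> F (tens v) = G (tens v)"
  shows "F = G"
proof (rule homogeneous_linear_eqI[OF tp gr F G])
  fix v assume v: "\<forall>i\<in>{1..n}. v i \<in> V0 \<union> V1"
  show "F (tens v) = G (tens v)"
  proof (cases "\<exists>i\<in>{1..n}. v i = 0")
    case True
    then have "tens v = 0" using tensor_zero[OF tp] by blast
    then show ?thesis using linear_zero[OF F] linear_zero[OF G] by simp
  qed (use v eq in blast)
qed

lemma permutes_homog: "homog v \<Longrightarrow> \<sigma> permutes {1..n} \<Longrightarrow> homog (\<lambda>i. v (\<sigma> i))"
  using permutes_in_image[of \<sigma> "{1..n}"] by blast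

abbreviation "\<phi> \<equiv> sign_action n V0 V1 sW tens"

lemmas \<phi>_linear = sign_action_props(1)[OF tp gr]

lemma \<phi>_homog:
  assumes "\<sigma> permutes {1..n}" "homog v"
  shows "\<phi> \<sigma> (tens v) = sW (koszul_sign n \<sigma> (\<lambda>i. hdeg V0 (v i))) (tens (\<lambda>i. v (inv_into UNIV \<sigma> i)))"
  by (rule sign_action_props(2)[OF tp gr assms(1)]) (use assms(2) in blast)

lemma \<phi>_id: "\<phi> id = id"
proof (rule linear_eqI_homog)
  show "Vector_Spaces.linear sW sW (\<phi> id)" by (rule \<phi>_linear) (rule permutes_id)
  show "Vector_Spaces.linear sW sW id" using W.linear_id .
qed (use \<phi>_homog[OF permutes_id] in simp)

text \<open>After applying \<open>\<phi> \<rho>\<close>, position \<open>i\<close> carries the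
  degree of the factor formerly at the preimage of \<open>i\<close>. This is the shifted degree
  function in \<open>koszul_sign_compose\<close>.\<close>

lemma \<phi>_comp:
  assumes \<sigma>: "\<sigma> permutes {1..n}" and \<rho>: "\<rho> permutes {1..n}"
  shows "\<phi> (\<sigma> \<circ> \<rho>) = \<phi> \<sigma> \<circ> \<phi> \<rho>"
proof (rule linear_eqI_homog)
  show "Vector_Spaces.linear sW sW (\<phi> (\<sigma> \<circ> \<rho>))"
    by (rule \<phi>_linear) (rule permutes_compose[OF \<rho> \<sigma>])
  show "Vector_Spaces.linear sW sW (\<phi> \<sigma> \<circ> \<phi> \<rho>)"
    by (intro Vector_Spaces.linear_compose[of _ sW] \<phi>_linear \<sigma> \<rho>)
  fix v assume v: "homog v"
  have inv: "inv_into UNIV (\<sigma> \<circ> \<rho>) = inv_into UNIV \<rho> \<circ> inv_into UNIV \<sigma>"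
    by (rule o_inv_distrib) (use \<sigma> \<rho> permutes_bij in blast)+
  have "(\<phi> \<sigma> \<circ> \<phi> \<rho>) (tens v) = sW (koszul_sign n \<rho> (\<lambda>i. hdeg V0 (v i)))
      (\<phi> \<sigma> (tens (\<lambda>i. v (inv_into UNIV \<rho> i))))"
    using \<phi>_linear[OF \<sigma>] by (simp add: \<phi>_homog[OF \<rho> v] Vector_Spaces.linear_iff)
  also have "\<dots> = sW (koszul_sign n (\<sigma> \<circ> \<rho>) (\<lambda>i. hdeg V0 (v i)))
      (tens (\<lambda>i. v (inv_into UNIV (\<sigma> \<circ> \<rho>) i)))"
    unfolding \<phi>_homog[OF \<sigma> permutes_homog[OF v permutes_inv[OF \<rho>]]] koszul_sign_compose[OF \<sigma> \<rho>] inv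
    by (simp add: mult.commute)
  also have "\<dots> = \<phi> (\<sigma> \<circ> \<rho>) (tens v)"
    by (rule \<phi>_homog[OF permutes_compose[OF \<rho> \<sigma>] v, symmetric])
  finally show "\<phi> (\<sigma> \<circ> \<rho>) (tens v) = (\<phi> \<sigma> \<circ> \<phi> \<rho>) (tens v)" ..
qed

end

text \<open>The bases enter only through these properties: \<open>\<tau>\<close> is a linear
  involution exchanging the two homogeneous parts.\<close>

locale graded_tensor_power_swap = graded_tensor_power n sV sW tens V0 V1
  for n sV and sW :: "complex \<Rightarrow> 'w::ab_group_add \<Rightarrow> 'w" and tens :: "(nat \<Rightarrow> 'v::ab_group_add) \<Rightarrow> 'w"
    and V0 V1 +
  fixes \<tau> :: "'v \<Rightarrow> 'v"
  assumes \<tau>_linear: "Vector_Spaces.linear sV sV \<tau>"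
    and \<tau>_V0: "v \<in> V0 \<Longrightarrow> \<tau> v \<in> V1" and \<tau>_V1: "v \<in> V1 \<Longrightarrow> \<tau> v \<in> V0"
    and \<tau>_\<tau> [simp]: "\<tau> (\<tau> v) = v"
begin

lemma \<tau>_0 [simp]: "\<tau> v = 0 \<longleftrightarrow> v = 0"
proof -
  have "\<tau> 0 = 0" by (rule linear_zero[OF \<tau>_linear])
  then show ?thesis by (metis \<tau>_\<tau>)
qed

lemma \<tau>_homog: "homog v \<Longrightarrow> homog (\<lambda>i. \<tau> (v i))"
  using \<tau>_V0 \<tau>_V1 \<tau>_0 by blast

lemma hdeg_\<tau>: "v \<in> (V0 \<union> V1) - {0} \<Longrightarrow> hdeg V0 (\<tau> v) = 1 - hdeg V0 v"
proof -
  assume v: "v \<in> (V0 \<union> V1) - {0}"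
  have "w \<notin> V0" if "w \<in> V1" "w \<noteq> 0" for w
    using gr that unfolding is_graded_space_def by blast
  moreover have "\<tau> v \<noteq> 0" using v by simp
  ultimately show ?thesis using v \<tau>_V0 \<tau>_V1 by (auto simp: hdeg_def)
qed

abbreviation "T \<equiv> twist_T n V0 V1 sW tens \<tau>"

lemmas T_linear = twist_T_props(1)[OF tp gr \<tau>_linear]

lemma T_homog:
  "homog y \<Longrightarrow> T (tens y) = sW ((-1) ^ (\<Sum>i=1..n. (n - i) * hdeg V0 (y i))) (tens (\<lambda>i. \<tau> (y i)))"
  by (rule twist_T_props(2)[OF tp gr \<tau>_linear]) blast

text \<open>At each position exactly one of the factors before and after \<open>\<tau>\<close> is
  odd. The exponents of the two applications thus add up to the sum of all \<open>n - i\<close>,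
  which is \<open>n choose 2\<close>.\<close>

lemma T_T: "T (T x) = sW ((-1) ^ (n choose 2)) x"
proof -
  have "T \<circ> T = sW ((-1) ^ (n choose 2))"
  proof (rule linear_eqI_homog)
    show "Vector_Spaces.linear sW sW (T \<circ> T)" by (intro Vector_Spaces.linear_compose[of _ sW] T_linear)
    show "Vector_Spaces.linear sW sW (sW ((-1) ^ (n choose 2)))"
      by (simp add: Vector_Spaces.linear_iff W.vector_space_axioms W.scale_right_distrib)
    fix v assume v: "homog v"
    have "(\<Sum>i=1..n. (n - i) * hdeg V0 (v i)) + (\<Sum>i=1..n. (n - i) * hdeg V0 (\<tau> (v i)))
        = (\<Sum>i=1..n. n - i)"
      unfolding sum.distrib[symmetric] using v hdeg_\<tau> by (intro sum.cong) (auto simp: hdeg_def)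
    also have "\<dots> = (\<Sum>i<n. i)"
      by (rule sum.reindex_bij_witness[where i = "\<lambda>i. n - i" and j = "\<lambda>i. n - i"]) auto
    also have "\<dots> = n choose 2"
      using gauss_sum_nat[of "n - 1"] by (cases n) (simp_all add: choose_two lessThan_Suc_atMost atMost_atLeast0 mult.commute)
    finally show "(T \<circ> T) (tens v) = sW ((-1) ^ (n choose 2)) (tens v)"
      using T_linear by (simp add: T_homog[OF v] T_homog[OF \<tau>_homog[OF v]] Vector_Spaces.linear_iff
          flip: power_add)
  qed
  then show ?thesis by (metis comp_apply)
qed

lemma T_\<phi>:
  assumes \<sigma>: "\<sigma> permutes {1..n}"
  shows "T (\<phi> \<sigma> x) = sW (of_int (sign \<sigma>)) (\<phi> \<sigma> (T x))"
proof -
  let ?q = "inv_into UNIV \<sigma>"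
  have "T \<circ> \<phi> \<sigma> = (\<lambda>x. sW (of_int (sign \<sigma>)) (\<phi> \<sigma> (T x)))"
  proof (rule linear_eqI_homog)
    show "Vector_Spaces.linear sW sW (T \<circ> \<phi> \<sigma>)" by (intro Vector_Spaces.linear_compose[of _ sW] T_linear \<phi>_linear \<sigma>)
    show "Vector_Spaces.linear sW sW (\<lambda>x. sW (of_int (sign \<sigma>)) (\<phi> \<sigma> (T x)))"
      using T_linear \<phi>_linear[OF \<sigma>] unfolding Vector_Spaces.linear_iff
      by (simp add: W.scale_right_distrib mult.commute)
    fix v assume v: "homog v"
    let ?d = "\<lambda>i. hdeg V0 (v i)"
    have "(T \<circ> \<phi> \<sigma>) (tens v) = sW (koszul_sign n \<sigma> ?d) (T (tens (\<lambda>i. v (?q i))))"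
      using T_linear by (simp add: \<phi>_homog[OF \<sigma> v] Vector_Spaces.linear_iff)
    also have "\<dots> = sW (koszul_sign n \<sigma> ?d * (-1) ^ (\<Sum>i=1..n. (n - i) * ?d (?q i)))
        (tens (\<lambda>i. \<tau> (v (?q i))))"
      by (simp add: T_homog[OF permutes_homog[OF v permutes_inv[OF \<sigma>]]])
    also have "koszul_sign n \<sigma> ?d * (-1) ^ (\<Sum>i=1..n. (n - i) * ?d (?q i))
      = of_int (sign \<sigma>) * koszul_sign n \<sigma> (\<lambda>i. 1 - ?d i) * (-1) ^ (\<Sum>i=1..n. (n - i) * ?d i)"
      by (rule koszul_sign_twist[OF \<sigma>]) (simp add: hdeg_def)
    \<comment> \<open>The complemented degrees are those of the factors of
      \<open>T (tens v)\<close>, on which \<open>\<phi> \<sigma>\<close> acts on the right-hand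
      side.\<close>
    also have "koszul_sign n \<sigma> (\<lambda>i. 1 - ?d i) = koszul_sign n \<sigma> (\<lambda>i. hdeg V0 (\<tau> (v i)))"
      unfolding koszul_sign_def by (rule prod.cong) (use v hdeg_\<tau> in auto)
    also have "sW (of_int (sign \<sigma>) * koszul_sign n \<sigma> (\<lambda>i. hdeg V0 (\<tau> (v i)))
          * (-1) ^ (\<Sum>i=1..n. (n - i) * ?d i)) (tens (\<lambda>i. \<tau> (v (?q i))))
        = sW (of_int (sign \<sigma>)) (\<phi> \<sigma> (T (tens v)))"
      using \<phi>_linear[OF \<sigma>] by (simp add: T_homog[OF v] \<phi>_homog[OF \<sigma> \<tau>_homog[OF v]]
          Vector_Spaces.linear_iff mult_ac)
    finally show "(T \<circ> \<phi> \<sigma>) (tens v) = sW (of_int (sign \<sigma>)) (\<phi> \<sigma> (T (tens v)))" .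
  qed
  then show ?thesis by (metis comp_apply)
qed

lemma sign_twist:
  assumes "2 \<le> n" "s\<^sup>2 = (-1) ^ (n choose 2)"
  shows "sign_twist sW n \<phi> (\<lambda>x. sW s (T x))"
proof -
  \<comment> \<open>This is the square of the sign \<open>(-1) ^ (n choose 2)\<close>, and it makes
    the rescaled operator an involution.\<close>
  have "s * (s * (-1) ^ (n choose 2)) = 1"
    using assms(2) by (simp flip: power2_eq_square mult.assoc power_even_eq)
  moreover have "Vector_Spaces.linear sW sW (\<lambda>x. sW s (T x))"
    using T_linear by (simp add: Vector_Spaces.linear_iff W.scale_right_distrib mult.commute)
  moreover have "T (sW c x) = sW c (T x)" "\<sigma> permutes {1..n} \<Longrightarrow> \<phi> \<sigma> (sW c x) = sW c (\<phi> \<sigma> x)" for \<sigma> c x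
    using T_linear \<phi>_linear unfolding Vector_Spaces.linear_iff by blast+
  moreover have "sW s (T (\<phi> \<sigma> x)) = sW (of_int (sign \<sigma>)) (\<phi> \<sigma> (sW s (T x)))"
    if "\<sigma> permutes {1..n}" for \<sigma> x
    using \<phi>_linear[OF that] unfolding T_\<phi>[OF that] Vector_Spaces.linear_iff
    by (metis W.scale_left_commute)
  moreover have "sW s (T (sW s (T x))) = sW (s * (s * (-1) ^ (n choose 2))) x" for x
    using T_linear unfolding Vector_Spaces.linear_iff by (simp add: T_T)
  ultimately show ?thesis
    using assms(1) \<phi>_linear \<phi>_id \<phi>_comp
    by (intro sign_twist.intro sign_twist_axioms.intro W.vector_space_axioms) simp_all
qed

end

section \<open>Nontriviality of conjugation with \<open>T\<close>\<close>

context graded_tensor_power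
begin

text \<open>A linear form \<open>l\<close> with \<open>l e = 1\<close> yields the multilinear form
  \<open>\<Prod>i=1..n. l (v i)\<close>. It factors through \<open>tens\<close> and has the value 1
  on this tensor.\<close>

lemma tens_const_nonzero:
  assumes "e \<noteq> 0"
  shows "tens (\<lambda>_. e) \<noteq> 0"
proof
  interpret C: vector_space "(*) :: complex \<Rightarrow> complex \<Rightarrow> complex"
    by unfold_locales (auto simp: algebra_simps)
  interpret VC: vector_space_pair sV "(*) :: complex \<Rightarrow> complex \<Rightarrow> complex" ..
  have "\<not> V.dependent {e}" using assms by simp
  then obtain l where l: "Vector_Spaces.linear sV (*) l" "l e = (1 :: complex)"
    using VC.linear_independent_extend[of "{e}" "\<lambda>_. 1"] by blast
  have "multilinear_map n sV (*) (\<lambda>v. \<Prod>i=1..n. l (v i))"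
    unfolding multilinear_map_def
  proof (intro conjI allI impI ballI)
    fix i v assume i: "i \<in> {1..n}"
    have "(\<Prod>j=1..n. l ((v(i := x)) j)) = l x * (\<Prod>j\<in>{1..n} - {i}. l (v j))" for x
      by (subst prod.remove[OF finite_atLeastAtMost i]) simp
    then have eq: "(\<lambda>x. \<Prod>j=1..n. l ((v(i := x)) j)) = (\<lambda>x. l x * (\<Prod>j\<in>{1..n} - {i}. l (v j)))"
      by blast
    have "l (x + y) = l x + l y" "l (sV c x) = c * l x" for x y c
      using l(1) unfolding Vector_Spaces.linear_iff by blast+
    then show "Vector_Spaces.linear sV (*) (\<lambda>x. \<Prod>j=1..n. l ((v(i := x)) j))"
      unfolding eq Vector_Spaces.linear_iff
      using V.vector_space_axioms C.vector_space_axioms by (simp add: distrib_right)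
  qed simp
  then have "\<exists>!g. Vector_Spaces.linear sW (*) g \<and> (\<forall>v. g (tens v) = (\<Prod>i=1..n. l (v i)))"
    using tp unfolding is_tensor_power_def by (elim conjE allE) (erule mp)
  then obtain g where g: "Vector_Spaces.linear sW (*) g" "\<And>v. g (tens v) = (\<Prod>i=1..n. l (v i))"
    by (elim ex1E conjE) blast
  assume "tens (\<lambda>_. e) = 0"
  then show False using g(2)[of "\<lambda>_. e"] linear_zero[OF g(1)] l(2) by simp
qed

end

text \<open>The projection onto the \<open>n\<close>-th tensor power of \<open>V0\<close> is a symmetric operator that is moved by
  conjugation with \<open>T\<close>, which carries it to the projection onto the tensor power of \<open>V1\<close>.\<close>

lemma (in graded_tensor_power_swap) conj_T_nontrivial:
  assumes e: "e \<in> V0" "e \<noteq> 0" and n: "1 \<le> n"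
  obtains b where "b \<in> carrier (commutant_algebra sW (\<phi> ` carrier (sym_group n)))"
    "b (tens (\<lambda>_. e)) \<noteq> 0" "b (T (tens (\<lambda>_. e))) = 0"
proof -
  obtain P where P: "\<And>d. Vector_Spaces.linear sV sV (P (d::nat))"
    "\<And>v d. v \<in> V0 \<union> V1 \<Longrightarrow> d \<le> 1 \<Longrightarrow> P d v = (if d = hdeg V0 v then v else 0)"
    using graded_projections[OF tp gr] by metis
  have P0: "P 0 v = (if v \<in> V0 then v else 0)" if "v \<in> V0 \<union> V1" for v
    using P(2)[OF that, of 0] by (simp add: hdeg_def)
  have "multilinear_map n sV sW (\<lambda>v. sW 1 (tens (\<lambda>i. P 0 (v (id i)))))"
    by (rule tensor_transform_multilinear[OF tp P(1) permutes_id])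
  then have "multilinear_map n sV sW (\<lambda>v. tens (\<lambda>i. P 0 (v i)))" by simp
  \<comment> \<open>The operator \<open>b\<close> is the tensor power of the projection
    \<open>P 0\<close>.\<close>
  then obtain b where b: "Vector_Spaces.linear sW sW b" "\<And>v. b (tens v) = tens (\<lambda>i. P 0 (v i))"
    using tensor_power_universal[OF tp W.vector_space_axioms] by blast
  have lin: "b (sW c x) = sW c (b x)" for c x
    using b(1) unfolding Vector_Spaces.linear_iff by blast
  have "b \<circ> \<phi> \<sigma> = \<phi> \<sigma> \<circ> b" if \<sigma>: "\<sigma> permutes {1..n}" for \<sigma>
  proof (rule linear_eqI_homog)
    let ?q = "inv_into UNIV \<sigma>"
    show "Vector_Spaces.linear sW sW (b \<circ> \<phi> \<sigma>)" "Vector_Spaces.linear sW sW (\<phi> \<sigma> \<circ> b)"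
      by (intro Vector_Spaces.linear_compose[of _ sW] b(1) \<phi>_linear \<sigma>)+
    fix v assume v: "homog v"
    have q: "?q i \<in> {1..n}" if "i \<in> {1..n}" for i
      using permutes_in_image[OF permutes_inv[OF \<sigma>]] that by blast
    have eq: "b (\<phi> \<sigma> (tens v)) = sW (koszul_sign n \<sigma> (\<lambda>i. hdeg V0 (v i))) (tens (\<lambda>i. P 0 (v (?q i))))"
      by (simp add: \<phi>_homog[OF \<sigma> v] lin b(2))
    \<comment> \<open>If all factors are even, \<open>b\<close> fixes the tensor and its permuted
      version. A single odd factor makes both sides vanish, wherever the permutation moves
      it.\<close>
    show "(b \<circ> \<phi> \<sigma>) (tens v) = (\<phi> \<sigma> \<circ> b) (tens v)"
    proof (cases "\<forall>i\<in>{1..n}. v i \<in> V0")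
      case True
      have "tens (\<lambda>i. P 0 (v (?q i))) = tens (\<lambda>i. v (?q i))" "tens (\<lambda>i. P 0 (v i)) = tens v"
        by (rule tensor_cong[OF tp]; use True P0 q in simp)+
      then show ?thesis using eq by (simp add: b(2) \<phi>_homog[OF \<sigma> v])
    next
      case False
      then obtain j where j: "j \<in> {1..n}" "v j \<notin> V0" by blast
      then have "P 0 (v j) = 0" using P0[of "v j"] v by auto
      moreover have "\<sigma> j \<in> {1..n}" using permutes_in_image[OF \<sigma>] j by blast
      ultimately have "tens (\<lambda>i. P 0 (v (?q i))) = 0" "tens (\<lambda>i. P 0 (v i)) = 0"
        using j by (auto intro: tensor_zero[OF tp, of "\<sigma> j"] tensor_zero[OF tp, of j]
            simp: permutes_inverses[OF \<sigma>])
      then show ?thesis using eq linear_zero[OF \<phi>_linear[OF \<sigma>]] by (simp add: b(2))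
    qed
  qed
  then have "b \<in> carrier (commutant_algebra sW (\<phi> ` carrier (sym_group n)))"
    using b(1) by (auto simp: commutant_algebra_def sym_group_carrier simp del: comp_def)
  moreover have "b (tens (\<lambda>_. e)) \<noteq> 0"
    using tens_const_nonzero[OF e(2)] P0[of e] e by (simp add: b(2))
  moreover have "b (T (tens (\<lambda>_. e))) = 0"
  proof -
    have "\<tau> e \<in> V1" "\<tau> e \<noteq> 0" using \<tau>_V0 e by auto
    then have "\<tau> e \<notin> V0" using gr unfolding is_graded_space_def by blast
    then have "P 0 (\<tau> e) = 0" using P0[of "\<tau> e"] \<open>\<tau> e \<in> V1\<close> by auto
    then have "tens (\<lambda>i. P 0 (\<tau> e)) = 0" using n by (intro tensor_zero[OF tp, of 1]) auto
    then show ?thesis using e by (simp add: T_homog lin b(2))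
  qed
  ultimately show ?thesis by (rule that)
qed

section \<open>From basis vectors to the swap operator\<close>

lemma (in vector_space) span_image_swap:
  assumes f: "Vector_Spaces.linear scale scale f"
    and b: "\<And>i. i \<in> I \<Longrightarrow> f (b i) = c i"
  shows "v \<in> span (b ` I) \<Longrightarrow> f v \<in> span (c ` I)"
proof -
  interpret VV: vector_space_pair scale scale ..
  have "f ` span (b ` I) = span (f ` b ` I)" using VV.linear_span_image[OF f] by simp
  also have "f ` b ` I = c ` I" using b by (auto simp: image_image)
  finally show "v \<in> span (b ` I) \<Longrightarrow> f v \<in> span (c ` I)" by blast
qed

text \<open>The exchange of \<open>V0\<close> and \<open>V1\<close> extends from basis vectors to
  their spans. The identity \<open>\<tau> (\<tau> v) = v\<close> extends further to sums of even and
  odd vectors.\<close>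

lemma graded_tensor_power_swapI:
  assumes gr: "is_graded_space sV V0 V1" and tp: "is_tensor_power n sV sW tens"
    and t: "V0 = Modules.module.span sV (t ` {1..k})" and u: "V1 = Modules.module.span sV (u ` {1..k})"
    and \<tau>: "Vector_Spaces.linear sV sV \<tau>"
    and \<tau>_t: "\<forall>i\<in>{1..k}. \<tau> (t i) = u i" and \<tau>_u: "\<forall>i\<in>{1..k}. \<tau> (u i) = t i"
  shows "graded_tensor_power_swap n sV sW tens V0 V1 \<tau>"
proof -
  interpret graded_tensor_power n sV sW tens V0 V1 by unfold_locales fact+
  interpret VV: vector_space_pair sV sV ..
  have "\<tau> v \<in> V1" if "v \<in> V0" for v
    using V.span_image_swap[OF \<tau>, of "{1..k}" t u] \<tau>_t that unfolding t u by blast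
  moreover have "\<tau> v \<in> V0" if "v \<in> V1" for v
    using V.span_image_swap[OF \<tau>, of "{1..k}" u t] \<tau>_u that unfolding t u by blast
  moreover have "\<tau> (\<tau> v) = v" for v
  proof -
    have inv: "\<tau> (\<tau> x) = x" if "x \<in> V.span S" "\<And>y. y \<in> S \<Longrightarrow> \<tau> (\<tau> y) = y" for x S
      using VV.linear_eq_on[OF Vector_Spaces.linear_compose[OF \<tau> \<tau>] V.linear_id that(1)] that(2) by simp
    have "\<tau> (\<tau> x) = x" if "x \<in> V0" for x
      by (rule inv[OF that[unfolded t]]) (use \<tau>_t \<tau>_u in auto)
    moreover have "\<tau> (\<tau> x) = x" if "x \<in> V1" for x
      by (rule inv[OF that[unfolded u]]) (use \<tau>_t \<tau>_u in auto)
    moreover obtain x y where "x \<in> V0" "y \<in> V1" "v = x + y"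
      using gr unfolding is_graded_space_def by blast
    ultimately show ?thesis by (simp add: VV.linear_add[OF \<tau>])
  qed
  ultimately show ?thesis
    using \<tau> graded_tensor_power_axioms
    by (intro graded_tensor_power_swap.intro graded_tensor_power_swap_axioms.intro)
qed

section \<open>Involutive automorphisms\<close>

lemma algebra_Aut_Bij: "w \<in> carrier (algebra_Aut R) \<Longrightarrow> w \<in> carrier (BijGroup (carrier R))"
  by (auto simp: algebra_Aut_def BijGroup_def Bij_def algebra_iso_def ring_iso_def)

lemma algebra_Aut_simps:
  "\<one>\<^bsub>algebra_Aut R\<^esub> = \<one>\<^bsub>BijGroup (carrier R)\<^esub>"
  "w \<otimes>\<^bsub>algebra_Aut R\<^esub> w' = w \<otimes>\<^bsub>BijGroup (carrier R)\<^esub> w'"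
  by (simp_all add: algebra_Aut_def)

lemma one_algebra_Aut:
  "\<one>\<^bsub>algebra_Aut R\<^esub> = (\<lambda>x\<in>carrier R. x)"
  by (simp add: algebra_Aut_def BijGroup_def)

lemma one_in_algebra_Aut:
  assumes "ring R" and smult: "\<And>c x. x \<in> carrier R \<Longrightarrow> c \<odot>\<^bsub>R\<^esub> x \<in> carrier R"
  shows "\<one>\<^bsub>algebra_Aut R\<^esub> \<in> carrier (algebra_Aut R)"
proof -
  interpret ring R by fact
  have "bij_betw (\<lambda>x\<in>carrier R. x) (carrier R) (carrier R)"
    using id_Bij[of "carrier R"] by (simp add: Bij_def)
  then show ?thesis
    unfolding one_algebra_Aut
    by (auto simp: algebra_Aut_def algebra_iso_def algebra_linear_def smult intro!: ring_iso_memI)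
qed

text \<open>Unit laws and associativity come from the group of all bijections of the carrier, which
  has the same product and unit.\<close>

lemma algebra_Aut_involution:
  fixes R :: "(complex, 'a) module"
  defines "Q \<equiv> algebra_Aut R"
  assumes one: "\<one>\<^bsub>Q\<^esub> \<in> carrier Q"
    and w: "w \<in> carrier Q" "w \<otimes>\<^bsub>Q\<^esub> w = \<one>\<^bsub>Q\<^esub>"
  shows "subgroup {\<one>\<^bsub>Q\<^esub>, w} Q" and "group (Q\<lparr>carrier := {\<one>\<^bsub>Q\<^esub>, w}\<rparr>)"
    and "w \<noteq> \<one>\<^bsub>Q\<^esub> \<Longrightarrow> Q\<lparr>carrier := {\<one>\<^bsub>Q\<^esub>, w}\<rparr> \<cong> integer_mod_group 2"
proof -
  interpret Bij: group "BijGroup (carrier R)" by (rule group_BijGroup)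
  have Q: "\<one>\<^bsub>Q\<^esub> \<otimes>\<^bsub>Q\<^esub> x = x" "x \<otimes>\<^bsub>Q\<^esub> \<one>\<^bsub>Q\<^esub> = x" if "x \<in> carrier Q" for x
    using algebra_Aut_Bij[of x R] that unfolding Q_def by (simp_all add: algebra_Aut_simps)
  have assoc: "x \<otimes>\<^bsub>Q\<^esub> (y \<otimes>\<^bsub>Q\<^esub> z) = x \<otimes>\<^bsub>Q\<^esub> y \<otimes>\<^bsub>Q\<^esub> z"
    if "x \<in> carrier Q" "y \<in> carrier Q" "z \<in> carrier Q" for x y z
    using algebra_Aut_Bij[of x R] algebra_Aut_Bij[of y R] algebra_Aut_Bij[of z R] that
    unfolding Q_def by (simp add: algebra_Aut_simps Bij.m_assoc)
  \<comment> \<open>The inverse is a definite description over the carrier of \<open>Q\<close>, so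
    uniqueness has to be shown among all its elements.\<close>
  have inv: "inv\<^bsub>Q\<^esub> x = x" if "x \<in> {\<one>\<^bsub>Q\<^esub>, w}" for x
  proof -
    have x: "x \<in> carrier Q" "x \<otimes>\<^bsub>Q\<^esub> x = \<one>\<^bsub>Q\<^esub>" using that one w Q by auto
    have "y = x" if y: "y \<in> carrier Q" "x \<otimes>\<^bsub>Q\<^esub> y = \<one>\<^bsub>Q\<^esub>" for y
      using assoc[OF x(1) x(1) y(1)] x y Q by simp
    then show ?thesis unfolding m_inv_def using x by (intro the_equality) auto
  qed
  show "subgroup {\<one>\<^bsub>Q\<^esub>, w} Q"
    using one w Q inv by (intro subgroup.intro) auto
  show "group (Q\<lparr>carrier := {\<one>\<^bsub>Q\<^esub>, w}\<rparr>)"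
    using one w Q by (intro groupI) auto
  show "Q\<lparr>carrier := {\<one>\<^bsub>Q\<^esub>, w}\<rparr> \<cong> integer_mod_group 2" if "w \<noteq> \<one>\<^bsub>Q\<^esub>"
  proof -
    have c: "carrier (integer_mod_group 2) = {0, 1}"
      by (auto simp: carrier_integer_mod_group)
    have "(\<lambda>x. if x = w then 1 else 0 :: int) \<in> iso (Q\<lparr>carrier := {\<one>\<^bsub>Q\<^esub>, w}\<rparr>) (integer_mod_group 2)"
      unfolding iso_def hom_def c bij_betw_def using that one w Q by auto
    then show ?thesis unfolding is_iso_def by blast
  qed
qed

context sign_twist
begin

text \<open>Conjugation with an involution is its own inverse, hence bijective. It is restricted to
  the carrier because the elements of \<open>algebra_Aut\<close> are extensional.\<close>

lemma conj_U_Aut: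
  defines "w \<equiv> \<lambda>b\<in>carrier sym_alg. U \<circ> b \<circ> U"
  shows "w \<in> carrier (algebra_Aut sym_alg)"
    and "w \<otimes>\<^bsub>algebra_Aut sym_alg\<^esub> w = \<one>\<^bsub>algebra_Aut sym_alg\<^esub>"
proof -
  interpret R: ring sym_alg by (rule sym_alg_ring)
  have ww: "w b \<in> carrier sym_alg" "w (w b) = b" if "b \<in> carrier sym_alg" for b
    using that conj_U_closed by (auto simp: w_def fun_eq_iff)
  then have bij: "bij_betw w (carrier sym_alg) (carrier sym_alg)"
    by (intro bij_betwI[of _ _ _ w]) auto
  have ops: "b \<oplus>\<^bsub>sym_alg\<^esub> c = (\<lambda>x. b x + c x)" "b \<otimes>\<^bsub>sym_alg\<^esub> c = (\<lambda>x. b (c x))"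
      "a \<odot>\<^bsub>sym_alg\<^esub> b = (\<lambda>x. sW a (b x))" "\<one>\<^bsub>sym_alg\<^esub> = id" for a b c
    by (auto simp: commutant_algebra_def)
  have w: "w b = (\<lambda>x. U (b (U x)))" if "b \<in> carrier sym_alg" for b
    using that by (simp add: w_def comp_def)
  have "w \<in> algebra_iso sym_alg sym_alg"
    unfolding algebra_iso_def algebra_linear_def
    using ww bij R.a_closed R.m_closed sym_alg_smult R.one_closed
    by (auto simp: w U_lin ops[unfolded comp_def] intro!: ring_iso_memI)
  then show w': "w \<in> carrier (algebra_Aut sym_alg)" by (simp add: algebra_Aut_def w_def)
  have "w \<in> Bij (carrier sym_alg)" using algebra_Aut_Bij[OF w'] by (simp add: BijGroup_def)
  then show "w \<otimes>\<^bsub>algebra_Aut sym_alg\<^esub> w = \<one>\<^bsub>algebra_Aut sym_alg\<^esub>"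
    unfolding algebra_Aut_simps by (auto simp: BijGroup_def compose_def ww fun_eq_iff)
qed

end

section \<open>The isomorphism\<close>

theorem theorem1p12:
  fixes sV :: "complex \<Rightarrow> 'v::ab_group_add \<Rightarrow> 'v"
    and sW :: "complex \<Rightarrow> 'w::ab_group_add \<Rightarrow> 'w"
    and V0 V1 :: "'v set" and t u :: "nat \<Rightarrow> 'v" and \<tau> :: "'v \<Rightarrow> 'v"
    and tens :: "(nat \<Rightarrow> 'v) \<Rightarrow> 'w" and k n :: nat and \<epsilon> s :: complex
    and \<phi> :: "(nat \<Rightarrow> nat) \<Rightarrow> 'w \<Rightarrow> 'w" and T :: "'w \<Rightarrow> 'w"
    and A B :: "(complex, 'w \<Rightarrow> 'w) module"
    and \<omega> :: "('w \<Rightarrow> 'w) \<Rightarrow> ('w \<Rightarrow> 'w)"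
    and H :: "(('w \<Rightarrow> 'w) \<Rightarrow> ('w \<Rightarrow> 'w)) monoid"
    and BH :: "(complex, (('w \<Rightarrow> 'w) \<Rightarrow> ('w \<Rightarrow> 'w)) \<Rightarrow> ('w \<Rightarrow> 'w)) module"
    and BZ2 :: "(complex, int \<Rightarrow> ('w \<Rightarrow> 'w)) module"
  assumes V: "is_graded_space sV V0 V1"
    and dims: "vector_space.dim sV V0 = k" "vector_space.dim sV V1 = k" and k: "k \<ge> 1"
    and n: "n \<ge> 2"
    and W: "is_tensor_power n sV sW tens"
    and \<phi>: "\<phi> = sign_action n V0 V1 sW tens"
    and A: "A = commutant_algebra sW (\<phi> ` carrier (alt_group n))"
    and B: "B = commutant_algebra sW (\<phi> ` carrier (sym_group n))"
    and t: "is_basis_of sV k t V0" and u: "is_basis_of sV k u V1"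
    and \<tau>_lin: "Vector_Spaces.linear sV sV \<tau>"
    and \<tau>_t: "\<forall>i\<in>{1..k}. \<tau> (t i) = u i" and \<tau>_u: "\<forall>i\<in>{1..k}. \<tau> (u i) = t i"
    and T: "T = twist_T n V0 V1 sW tens \<tau>"
    and \<epsilon>: "\<epsilon> = (-1) ^ (n choose 2)" and s: "s\<^sup>2 = \<epsilon>"
    and \<omega>: "\<omega> = (\<lambda>b\<in>carrier B. \<lambda>x. sW \<epsilon> (T (b (T x))))"
    and H: "H = (algebra_Aut B)\<lparr>carrier := {\<one>\<^bsub>algebra_Aut B\<^esub>, \<omega>}\<rparr>"
    and BH: "BH = crossed_product B H (\<lambda>h. h)"
    and BZ2: "BZ2 = crossed_product B (integer_mod_group 2)
      (\<lambda>j. if j = 0 then \<one>\<^bsub>algebra_Aut B\<^esub> else \<omega>)"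
  shows "\<omega> \<in> carrier (algebra_Aut B) \<and>
    \<omega> \<noteq> \<one>\<^bsub>algebra_Aut B\<^esub> \<and> \<omega> \<otimes>\<^bsub>algebra_Aut B\<^esub> \<omega> = \<one>\<^bsub>algebra_Aut B\<^esub> \<and>
    subgroup (carrier H) (algebra_Aut B) \<and> H \<cong> integer_mod_group 2 \<and>
    (\<exists>\<zeta>. \<zeta> \<in> algebra_linear BH A \<and>
      (\<forall>b\<in>carrier B. \<zeta> (pure_tensor B H b \<one>\<^bsub>H\<^esub>) = b \<and>
        \<zeta> (pure_tensor B H b \<omega>) = (\<lambda>x. sW s (b (T x)))) \<and>
      (\<forall>\<zeta>'\<in>algebra_linear BH A.
        (\<forall>b\<in>carrier B. \<zeta>' (pure_tensor B H b \<one>\<^bsub>H\<^esub>) = b \<and>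
          \<zeta>' (pure_tensor B H b \<omega>) = (\<lambda>x. sW s (b (T x)))) \<longrightarrow>
        (\<forall>x\<in>carrier BH. \<zeta>' x = \<zeta> x)) \<and>
      \<zeta> \<in> algebra_iso BH A) \<and>
    algebra_iso A BH \<noteq> {} \<and> algebra_iso BH BZ2 \<noteq> {}"
proof -
  interpret S: graded_tensor_power_swap n sV sW tens V0 V1 \<tau>
    by (rule graded_tensor_power_swapI[OF V W _ _ \<tau>_lin \<tau>_t \<tau>_u])
      (use t u in \<open>simp_all add: is_basis_of_def\<close>)
  define U where "U = (\<lambda>x. sW s (T x))"
  interpret tw: sign_twist sW n \<phi> U
    unfolding U_def \<phi> T by (rule S.sign_twist[OF n]) (use s \<epsilon> in simp)
  define Q where "Q = algebra_Aut B"
  have lin: "b (sW c x) = sW c (b x)" if "b \<in> carrier B" for b c x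
    using that unfolding B tw.sym_alg_iff Vector_Spaces.linear_iff by blast
  have T_scale: "T (sW c x) = sW c (T x)" for c x
    using S.T_linear unfolding T Vector_Spaces.linear_iff by blast
  \<comment> \<open>The two factors \<open>s\<close> in \<open>U b U\<close> combine to
    \<open>s\<^sup>2 = \<epsilon>\<close>.\<close>
  have \<omega>_U: "\<omega> = (\<lambda>b\<in>carrier B. U \<circ> b \<circ> U)"
    unfolding \<omega>
    by (rule restrict_ext) (auto simp: U_def lin T_scale s[symmetric] power2_eq_square)
  have one_Q: "\<one>\<^bsub>Q\<^esub> = (\<lambda>b\<in>carrier B. b)" by (simp add: Q_def one_algebra_Aut)
  have one_mem: "\<one>\<^bsub>Q\<^esub> \<in> carrier Q"
    unfolding Q_def B using tw.sym_alg_ring tw.sym_alg_smult by (rule one_in_algebra_Aut)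
  have \<omega>_mem: "\<omega> \<in> carrier Q" and \<omega>\<omega>: "\<omega> \<otimes>\<^bsub>Q\<^esub> \<omega> = \<one>\<^bsub>Q\<^esub>"
    using tw.conj_U_Aut unfolding \<omega>_U Q_def B by blast+
  \<comment> \<open>Since \<open>k\<close> is positive, \<open>t 1\<close> is a nonzero even vector.
    On its tensor power the projection \<open>b\<close> from \<open>conj_T_nontrivial\<close> is
    nonzero, while its image under \<open>\<omega>\<close> vanishes.\<close>
  have \<omega>_neq: "\<omega> \<noteq> \<one>\<^bsub>Q\<^esub>"
  proof
    assume eq: "\<omega> = \<one>\<^bsub>Q\<^esub>"
    have "t 1 \<in> t ` {1..k}" using k by simp
    moreover have "V0 = S.V.span (t ` {1..k})" "\<not> S.V.dependent (t ` {1..k})"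
      using t by (simp_all add: is_basis_of_def)
    ultimately have e: "t 1 \<in> V0" "t 1 \<noteq> 0"
      using S.V.span_base[of "t 1"] S.V.dependent_zero[of "t ` {1..k}"] by auto
    obtain b where b: "b \<in> carrier B" "b (tens (\<lambda>_. t 1)) \<noteq> 0" "b (T (tens (\<lambda>_. t 1))) = 0"
      using S.conj_T_nontrivial[OF e] n unfolding B \<phi> T by auto
    have "b (tens (\<lambda>_. t 1)) = sW \<epsilon> (T (b (T (tens (\<lambda>_. t 1)))))"
      using fun_cong[OF fun_cong[OF eq, of b], of "tens (\<lambda>_. t 1)"] b(1) by (simp add: \<omega> one_Q)
    then show False using b(2,3) T_scale[of 0 0] by simp
  qed
  have H_Q: "H = Q\<lparr>carrier := {\<one>\<^bsub>Q\<^esub>, \<omega>}\<rparr>" by (simp add: H Q_def)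
  have H_simps: "carrier H = {\<one>\<^bsub>H\<^esub>, \<omega>}" "\<omega> \<noteq> \<one>\<^bsub>H\<^esub>" "\<one>\<^bsub>H\<^esub> = \<one>\<^bsub>Q\<^esub>"
    using \<omega>_neq by (simp_all add: H_Q)
  note invol = algebra_Aut_involution[of B \<omega>, folded Q_def, OF one_mem \<omega>_mem \<omega>\<omega>, folded H_Q]
  define \<zeta> where "\<zeta> f x = f \<one>\<^bsub>H\<^esub> x + f \<omega> (U x)" for f :: "(('w \<Rightarrow> 'w) \<Rightarrow> 'w \<Rightarrow> 'w) \<Rightarrow> 'w \<Rightarrow> 'w" and x
  have isos: "\<zeta> \<in> algebra_iso BH A" "algebra_iso A BH \<noteq> {}"
    unfolding BH A B \<zeta>_def[abs_def]
    by (rule tw.crossed_product_iso_alt_alg[OF invol(2) H_simps(1,2)];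
        simp add: H_simps(3) one_Q \<omega>_U B)+
  have Z2: "carrier (integer_mod_group 2) = {\<one>\<^bsub>integer_mod_group 2\<^esub>, 1}"
    by (auto simp: carrier_integer_mod_group)
  \<comment> \<open>The two crossed products are compared through \<open>A\<close>, by applying the
    same result to the integers modulo 2.\<close>
  have "algebra_iso A BZ2 \<noteq> {}"
    unfolding BZ2 A B
    by (rule tw.crossed_product_iso_alt_alg[OF group_integer_mod_group Z2])
      (simp_all add: one_Q[unfolded Q_def B] \<omega>_U B)
  then have BH_BZ2: "algebra_iso BH BZ2 \<noteq> {}"
    using algebra_iso_trans[OF isos(1)] by blast
  have B_zero: "\<zero>\<^bsub>B\<^esub> = (\<lambda>_. 0)" by (simp add: B commutant_algebra_def)
  have \<zeta>_pure: "\<zeta> (pure_tensor B H b \<one>\<^bsub>H\<^esub>) = b" "\<zeta> (pure_tensor B H b \<omega>) = (\<lambda>x. sW s (b (T x)))"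
    if "b \<in> carrier B" for b
    using H_simps(1,2) lin[OF that] by (auto simp: \<zeta>_def pure_tensor_def B_zero U_def fun_eq_iff)
  have \<zeta>_lin: "\<zeta> \<in> algebra_linear BH A" using isos(1) by (simp add: algebra_iso_def)
  have uniq: "\<zeta>' f = \<zeta> f"
    if \<zeta>': "\<zeta>' \<in> algebra_linear BH A"
      and pure: "\<forall>b\<in>carrier B. \<zeta>' (pure_tensor B H b \<one>\<^bsub>H\<^esub>) = b \<and>
        \<zeta>' (pure_tensor B H b \<omega>) = (\<lambda>x. sW s (b (T x)))"
      and f: "f \<in> carrier BH" for \<zeta>' f
  proof -
    have fB: "f \<one>\<^bsub>H\<^esub> \<in> carrier B" "f \<omega> \<in> carrier B" "f \<in> extensional (carrier H)"
      using f H_simps(1) by (auto simp: BH crossed_product_def PiE_iff)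
    let ?p = "pure_tensor B H (f \<one>\<^bsub>H\<^esub>) \<one>\<^bsub>H\<^esub>" and ?q = "pure_tensor B H (f \<omega>) \<omega>"
    have "(\<lambda>_. 0) \<in> carrier B"
      using ring.ring_simprules(2)[OF tw.sym_alg_ring] unfolding B_zero[symmetric] B .
    then have pq: "?p \<in> carrier BH" "?q \<in> carrier BH"
      using fB by (auto simp: BH crossed_product_def pure_tensor_def B_zero)
    \<comment> \<open>Every element is the sum of two pure tensors, so additivity and the prescribed
      values determine the map.\<close>
    have "f = ?p \<oplus>\<^bsub>BH\<^esub> ?q"
    proof
      fix h show "f h = (?p \<oplus>\<^bsub>BH\<^esub> ?q) h"
        using fB(3) H_simps(1,2) extensional_arb[of f "carrier H" h]
        by (cases "h \<in> carrier H")
          (auto simp: BH crossed_product_def pure_tensor_def B_zero commutant_algebra_def B)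
    qed
    moreover have "\<zeta>'' (?p \<oplus>\<^bsub>BH\<^esub> ?q) = \<zeta>'' ?p \<oplus>\<^bsub>A\<^esub> \<zeta>'' ?q" if "\<zeta>'' \<in> algebra_linear BH A" for \<zeta>''
      using that pq by (simp add: algebra_linear_def)
    ultimately show ?thesis
      using \<zeta>' \<zeta>_lin pure \<zeta>_pure fB by metis
  qed
  have "\<exists>\<zeta>. \<zeta> \<in> algebra_linear BH A \<and>
      (\<forall>b\<in>carrier B. \<zeta> (pure_tensor B H b \<one>\<^bsub>H\<^esub>) = b \<and>
        \<zeta> (pure_tensor B H b \<omega>) = (\<lambda>x. sW s (b (T x)))) \<and>
      (\<forall>\<zeta>'\<in>algebra_linear BH A.
        (\<forall>b\<in>carrier B. \<zeta>' (pure_tensor B H b \<one>\<^bsub>H\<^esub>) = b \<and>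
          \<zeta>' (pure_tensor B H b \<omega>) = (\<lambda>x. sW s (b (T x)))) \<longrightarrow>
        (\<forall>x\<in>carrier BH. \<zeta>' x = \<zeta> x)) \<and>
      \<zeta> \<in> algebra_iso BH A"
    using \<zeta>_lin \<zeta>_pure uniq isos(1) by (intro exI[of _ \<zeta>]) blast
  moreover have "subgroup (carrier H) Q" using invol(1) by (simp add: H_Q)
  ultimately show ?thesis
    using \<omega>_mem \<omega>_neq \<omega>\<omega> invol(3) isos(2) BH_BZ2 unfolding Q_def by blast
qed

end
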